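(* Let $Z=(X,Y)\in\Omega$ satisfy $X_i(\mathbf 0)Y_i(\mathbf 0)>0$ for $i=1,2$. Then $Z$ is locally $\Sigma$-equivalent to the piecewise smooth system $\tilde Z=(\tilde X,\tilde Y)$ with $$\tilde Z(p)=\begin{cases}\tilde X(p)=(a,b), & p\in\mathcal U^+,\\ \tilde Y(p)=(a,b), & p\in\mathcal U^-,\end{cases}$$ where $a=\operatorname{sgn}(X_1(\mathbf 0))$ and $b=\operatorname{sgn}(X_2(\mathbf 0))$. In other words, $Z$ is $C^0$-equivalent to the continuous vector field $\tilde Z(p)=(a,b)$.
   Context: Setting. Fix $r\ge 1$ and a bounded open neighborhood $\mathcal U$ of the origin $\mathbf 0$ in $\mathbb R^2$. Let $\Sigma=\{(x_1,x_2)\in\mathcal U: x_1x_2=0\}$, $\mathcal U^+=\{x_1x_2>0\}$, $\mathcal U^-=\{x_1x_2<0\}$. Write $\Sigma=\Sigma_1\cup\Sigma_2$ with $\Sigma_1=\{x_1=0\}$, $\Sigma_2=\{x_2=0\}$; $\Sigma_1^{\pm}=\{(0,x_2):\pm x_2>0\}$ and $\Sigma_2^{\pm}=\{(x_1,0):\pm x_1>0\}$. $\Omega$ is the set of piecewise smooth vector fields $Z=(X,Y)$, where $X=(X_1,X_2)$, $Y=(Y_1,Y_2)$ are $C^r$ vector fields on $\overline{\mathcal U}$, with $Z=X$ on $\mathcal U^+$ and $Z=Y$ on $\mathcal U^-$. Regions of $\Sigma$. For $i=1,2$: crossing region $\Sigma_i^c=\{p\in\Sigma_i: X_iY_i(p)>0\}$;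 sliding region $\Sigma_i^s=\{p\in\Sigma_i^+:X_i(p)<0,Y_i(p)>0\}\cup\{p\in\Sigma_i^-:X_i(p)>0,Y_i(p)<0\}$; escaping region $\Sigma_i^e=\{p\in\Sigma_i^+:X_i(p)>0,Y_i(p)<0\}\cup\{p\in\Sigma_i^-:X_i(p)<0,Y_i(p)>0\}$. $\Sigma^{c},\Sigma^s,\Sigma^e$ are the unions over $i=1,2$. On $\Sigma_i^{s}\cup\Sigma_i^e$ the sliding vector field is the one-dimensional vector field $Z_i^s=\dfrac{Y_iX_j-X_iY_j}{Y_i-X_i}\Big|_{\Sigma_i}$, $j\neq i$. Trajectories of $Z$. For $p\neq\mathbf 0$: if $p\in\mathcal U^{+}$ (resp. $\mathcal U^-$) follow the trajectory of $X$ (resp. $Y$), where trajectories meeting $\Sigma^s\cup\Sigma^e$ transversally are regarded as relatively open (they do not reach $\Sigma^s\cup\Sigma^e$ in finite time); if $p\in\Sigma^c$ concatenate the trajectories of $X$ and $Y$ through $p$; if $p\in\Sigma_i^s\cup\Sigma_i^e$ follow the trajectory of $Z_i^s$; if $p\in\partial\Sigma_i^e\cup\partial\Sigma_i^s\cup\partial\Sigma_i^c$ and the one-sided limits $\lim_{q\to p^\pm}\varphi_Z(t;q)$ along $\Sigma_i$ coincide, the trajectory is this limit; for other such boundary points it is $\{p\}$. For $\mathbf 0$: if $\Sigma=\overline{\Sigma^c}$, it is the unique trajectory of $X$ or $Y$ that crosses the origin; if $\mathbf 0\in\overline{\Sigma_i^e\cup\Sigma_i^s}\cap\overline{\Sigma_j^c}$,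 $i\ne j$, it is the trajectory of $Z_i^s$; if $\mathbf 0\in\bigcap_{i=1,2}\overline{\Sigma_i^e\cup\Sigma_i^s}$, it is $\{\mathbf 0\}$. Equivalence. $Z,\tilde Z\in\Omega$ are locally $\Sigma$-equivalent if there are neighborhoods $\mathcal U_0,\tilde{\mathcal U}_0$ of the origin and an orientation preserving homeomorphism $h:\mathcal U_0\to\tilde{\mathcal U}_0$ mapping trajectories of $Z$ to trajectories of $\tilde Z$ and $\Sigma$ to $\Sigma$. *)

theory Defs
  imports "HOL-Analysis.Analysis" "HOL-Complex_Analysis.Winding_Numbers"
begin

type_synonym plane = "real^2"
type_synonym field2 = "plane \<Rightarrow> plane"
type_synonym germ = "real \<Rightarrow> plane"


subsection \<open>Piecewise smooth vector fields\<close>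

text \<open>\<open>C\<^sup>k\<close> on an open set \<open>W\<close>: all iterated directional derivatives up to order \<open>k\<close> exist
  and are continuous.\<close>

fun Ck_on :: "nat \<Rightarrow> plane set \<Rightarrow> field2 \<Rightarrow> bool" where
  "Ck_on 0 W F \<longleftrightarrow> continuous_on W F"
| "Ck_on (Suc k) W F \<longleftrightarrow>
     (\<forall>x\<in>W. F differentiable (at x)) \<and>
     (\<forall>v. Ck_on k W (\<lambda>x. frechet_derivative F (at x) v))"

text \<open>On a closed set, \<open>C\<^sup>k\<close> means: restriction of a \<open>C\<^sup>k\<close> map defined on an open superset.\<close>

definition Ck_on_closed :: "nat \<Rightarrow> plane set \<Rightarrow> field2 \<Rightarrow> bool" where
  "Ck_on_closed k S F \<longleftrightarrow>
     (\<exists>W G. open W \<and> S \<subseteq> W \<and> Ck_on k W G \<and> (\<forall>x\<in>S. F x = G x))"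

text \<open>A pair \<open>(X, Y)\<close> stands for the field equal to \<open>X\<close> on \<open>Upos U\<close> and to \<open>Y\<close> on \<open>Uneg U\<close>.\<close>

definition Omega :: "nat \<Rightarrow> plane set \<Rightarrow> (field2 \<times> field2) set" where
  "Omega r U = {(X, Y). Ck_on_closed r (closure U) X \<and> Ck_on_closed r (closure U) Y}"

definition Upos :: "plane set \<Rightarrow> plane set" where
  "Upos U = {p \<in> U. p$1 * p$2 > 0}"

definition Uneg :: "plane set \<Rightarrow> plane set" where
  "Uneg U = {p \<in> U. p$1 * p$2 < 0}"

definition Sig :: "plane set \<Rightarrow> plane set" where
  "Sig U = {p \<in> U. p$1 * p$2 = 0}"

definition Axis :: "plane set \<Rightarrow> 2 \<Rightarrow> plane set" where
  "Axis U i = {p \<in> U. p$i = 0}"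

definition Axis_pos :: "plane set \<Rightarrow> 2 \<Rightarrow> plane set" where
  "Axis_pos U i = {p \<in> Axis U i. \<forall>j. j \<noteq> i \<longrightarrow> p$j > 0}"

definition Axis_neg :: "plane set \<Rightarrow> 2 \<Rightarrow> plane set" where
  "Axis_neg U i = {p \<in> Axis U i. \<forall>j. j \<noteq> i \<longrightarrow> p$j < 0}"


subsection \<open>Crossing, sliding and escaping regions\<close>

definition Crossing :: "plane set \<Rightarrow> field2 \<times> field2 \<Rightarrow> 2 \<Rightarrow> plane set" where
  "Crossing U Z i = (case Z of (X, Y) \<Rightarrow> {p \<in> Axis U i. X p $ i * Y p $ i > 0})"

definition Sliding :: "plane set \<Rightarrow> field2 \<times> field2 \<Rightarrow> 2 \<Rightarrow> plane set" where
  "Sliding U Z i = (case Z of (X, Y) \<Rightarrow>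
     {p \<in> Axis_pos U i. X p $ i < 0 \<and> Y p $ i > 0} \<union>
     {p \<in> Axis_neg U i. X p $ i > 0 \<and> Y p $ i < 0})"

definition Escaping :: "plane set \<Rightarrow> field2 \<times> field2 \<Rightarrow> 2 \<Rightarrow> plane set" where
  "Escaping U Z i = (case Z of (X, Y) \<Rightarrow>
     {p \<in> Axis_pos U i. X p $ i > 0 \<and> Y p $ i < 0} \<union>
     {p \<in> Axis_neg U i. X p $ i < 0 \<and> Y p $ i > 0})"

text \<open>The sliding field on the \<open>i\<close>-th axis, as a planar vector: its \<open>i\<close>-th component vanishes
  and its other component is the one-dimensional field \<open>(Y\<^sub>i X\<^sub>j - X\<^sub>i Y\<^sub>j) / (Y\<^sub>i - X\<^sub>i)\<close>.
  Only meaningful where \<open>X\<^sub>i\<close> and \<open>Y\<^sub>i\<close> differ.\<close>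

definition slide_field :: "field2 \<times> field2 \<Rightarrow> 2 \<Rightarrow> field2" where
  "slide_field Z i p = (case Z of (X, Y) \<Rightarrow>
     (\<chi> j. (Y p $ i * X p $ j - X p $ i * Y p $ j) / (Y p $ i - X p $ i)))"


subsection \<open>Trajectories\<close>

text \<open>The rule for the trajectory through a point \<open>p\<close> is a local one, given as a predicate on
  curves \<open>g\<close> with \<open>g 0 = p\<close>, which constrains \<open>g\<close> only near time \<open>0\<close>.\<close>

definition solves :: "field2 \<Rightarrow> real set \<Rightarrow> (real \<Rightarrow> plane) \<Rightarrow> bool" where
  "solves F J g \<longleftrightarrow> (\<forall>s\<in>J. (g has_vector_derivative F (g s)) (at s within J))"

definition smooth_germ :: "field2 \<Rightarrow> germ \<Rightarrow> bool" where
  "smooth_germ F g \<longleftrightarrow> (\<exists>e>0. solves F {-e<..<e} g)"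

definition interior_germ :: "plane set \<Rightarrow> field2 \<times> field2 \<Rightarrow> germ \<Rightarrow> bool" where
  "interior_germ U Z g \<longleftrightarrow> (case Z of (X, Y) \<Rightarrow>
     (\<exists>e>0. g ` {-e<..<e} \<subseteq> Upos U \<and> solves X {-e<..<e} g) \<or>
     (\<exists>e>0. g ` {-e<..<e} \<subseteq> Uneg U \<and> solves Y {-e<..<e} g))"

text \<open>Follow \<open>F\<close> in the region \<open>A\<close> before time \<open>0\<close> and \<open>G\<close> in the region \<open>B\<close> after time \<open>0\<close>.\<close>

definition concat_germ ::
  "field2 \<Rightarrow> plane set \<Rightarrow> field2 \<Rightarrow> plane set \<Rightarrow> germ \<Rightarrow> bool" where
  "concat_germ F A G B g \<longleftrightarrow> (\<exists>e>0.
     g ` {-e<..<0} \<subseteq> A \<and> solves F {-e<..0} g \<and>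
     g ` {0<..<e} \<subseteq> B \<and> solves G {0..<e} g)"

definition crossing_germ :: "plane set \<Rightarrow> field2 \<times> field2 \<Rightarrow> germ \<Rightarrow> bool" where
  "crossing_germ U Z g \<longleftrightarrow> (case Z of (X, Y) \<Rightarrow>
     g 0 \<noteq> 0 \<and> (\<exists>i. g 0 \<in> Crossing U Z i) \<and>
     (concat_germ X (Upos U) Y (Uneg U) g \<or> concat_germ Y (Uneg U) X (Upos U) g))"

text \<open>Follow the sliding field inside the set \<open>S\<close>.  The condition that the normal components
  differ is automatic on the sliding and escaping regions; it matters on their boundary.\<close>

definition slide_germ :: "field2 \<times> field2 \<Rightarrow> 2 \<Rightarrow> plane set \<Rightarrow> germ \<Rightarrow> bool" where
  "slide_germ Z i S g \<longleftrightarrow> (\<exists>e>0.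
     g ` {-e<..<e} \<subseteq> {p \<in> S. fst Z p $ i \<noteq> snd Z p $ i} \<and>
     solves (slide_field Z i) {-e<..<e} g)"

definition sliding_germ :: "plane set \<Rightarrow> field2 \<times> field2 \<Rightarrow> germ \<Rightarrow> bool" where
  "sliding_germ U Z g \<longleftrightarrow> (\<exists>i. slide_germ Z i (Sliding U Z i \<union> Escaping U Z i) g)"

text \<open>\<open>is_boundary_limit U Z i p e g\<close>: for times in \<open>(-e, e)\<close> the one-sided limits, as \<open>q\<close> tends
  to \<open>p\<close> along the \<open>i\<close>-th axis, of the trajectories \<open>\<phi> q\<close> through \<open>q\<close> exist and both equal
  \<open>g\<close>.  The nearby trajectories may cross the axes repeatedly, and sliding ones may pass through
  boundary points separating two sliding or escaping arcs, where the sliding field still makes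
  sense.\<close>

definition nearby_germ :: "plane set \<Rightarrow> field2 \<times> field2 \<Rightarrow> germ \<Rightarrow> bool" where
  "nearby_germ U Z g \<longleftrightarrow> interior_germ U Z g \<or> crossing_germ U Z g \<or>
     (\<exists>i. slide_germ Z i (Axis U i \<inter> closure (Sliding U Z i \<union> Escaping U Z i) - {0}) g)"

definition is_boundary_limit ::
  "plane set \<Rightarrow> field2 \<times> field2 \<Rightarrow> 2 \<Rightarrow> plane \<Rightarrow> real \<Rightarrow> germ \<Rightarrow> bool" where
  "is_boundary_limit U Z i p e g \<longleftrightarrow> (\<exists>\<phi> :: plane \<Rightarrow> real \<Rightarrow> plane.
     \<forall>S \<in> {{q \<in> Axis U i. \<forall>j. j \<noteq> i \<longrightarrow> q$j > p$j}, {q \<in> Axis U i. \<forall>j. j \<noteq> i \<longrightarrow> q$j < p$j}}.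
       (\<forall>\<^sub>F q in at p within S.
          \<phi> q 0 = q \<and> (\<forall>t\<in>{-e<..<e}. nearby_germ U Z (\<lambda>s. \<phi> q (t + s)))) \<and>
       (\<forall>t\<in>{-e<..<e}. ((\<lambda>q. \<phi> q t) \<longlongrightarrow> g t) (at p within S)))"

definition constant_germ :: "germ \<Rightarrow> bool" where
  "constant_germ g \<longleftrightarrow> (\<exists>e>0. \<forall>s\<in>{-e<..<e}. g s = g 0)"

text \<open>Boundaries of the regions are taken relative to the axis.\<close>

definition boundary_germ :: "plane set \<Rightarrow> field2 \<times> field2 \<Rightarrow> germ \<Rightarrow> bool" where
  "boundary_germ U Z g \<longleftrightarrow> (let p = g 0 in
     p \<noteq> 0 \<and> (\<exists>i.
       p \<in> (top_of_set (Axis U i) frontier_of Escaping U Z i) \<union>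
           (top_of_set (Axis U i) frontier_of Sliding U Z i) \<union>
           (top_of_set (Axis U i) frontier_of Crossing U Z i) \<and>
       (if \<exists>e>0. \<exists>g'. is_boundary_limit U Z i p e g'
        then \<exists>e>0. is_boundary_limit U Z i p e g
        else constant_germ g)))"

text \<open>The rule at the origin.  If \<open>\<Sigma>\<close> is, near the origin, the closure of the crossing region,
  the trajectory is the integral curve of \<open>X\<close> or \<open>Y\<close> that passes through the origin within
  the region where that field governs the motion.  The second and third conditions can hold
  simultaneously in degenerate cases; then the origin is a trajectory by itself.\<close>

definition origin_germ :: "plane set \<Rightarrow> field2 \<times> field2 \<Rightarrow> germ \<Rightarrow> bool" where
  "origin_germ U Z g \<longleftrightarrow> (case Z of (X, Y) \<Rightarrow>
     g 0 = 0 \<and>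
     (if \<exists>d>0. Sig U \<inter> ball 0 d \<subseteq> closure (\<Union>i. Crossing U Z i) then
        concat_germ X (Upos U) X (Upos U) g \<or> concat_germ Y (Uneg U) Y (Uneg U) g
      else if \<forall>i. 0 \<in> closure (Escaping U Z i \<union> Sliding U Z i) then
        constant_germ g
      else
        \<exists>i j. i \<noteq> j \<and> 0 \<in> closure (Escaping U Z i \<union> Sliding U Z i) \<inter> closure (Crossing U Z j) \<and>
          slide_germ Z i (insert 0 (Sliding U Z i \<union> Escaping U Z i)) g))"

definition trajectory_germ :: "plane set \<Rightarrow> field2 \<times> field2 \<Rightarrow> germ \<Rightarrow> bool" where
  "trajectory_germ U Z g \<longleftrightarrow>
     interior_germ U Z g \<or> crossing_germ U Z g \<or> sliding_germ U Z g \<or>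
     boundary_germ U Z g \<or> origin_germ U Z g"

text \<open>Curves in \<open>V\<close> on a nonempty open time interval that obey the local rule \<open>P\<close> at every time,
  and the maximal ones among them.  With \<open>P = trajectory_germ U Z\<close>, a curve
  in \<open>Upos U\<close> or \<open>Uneg U\<close> cannot be continued to a sliding or escaping point, since
  the rule there forces the curve to stay on the axis.\<close>

definition rule_curves ::
  "(germ \<Rightarrow> bool) \<Rightarrow> plane set \<Rightarrow> (real set \<times> (real \<Rightarrow> plane)) set" where
  "rule_curves P V = {(I, \<gamma>). open I \<and> is_interval I \<and> I \<noteq> {} \<and> \<gamma> ` I \<subseteq> V \<and>
     (\<forall>t\<in>I. P (\<lambda>s. \<gamma> (t + s)))}"

definition maximal_curves ::
  "(germ \<Rightarrow> bool) \<Rightarrow> plane set \<Rightarrow> (real set \<times> (real \<Rightarrow> plane)) set" where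
  "maximal_curves P V = {(I, \<gamma>) \<in> rule_curves P V.
     \<forall>(I', \<gamma>') \<in> rule_curves P V. I \<subseteq> I' \<and> (\<forall>t\<in>I. \<gamma>' t = \<gamma> t) \<longrightarrow> I' = I}"

definition trajectories ::
  "plane set \<Rightarrow> field2 \<times> field2 \<Rightarrow> plane set \<Rightarrow> (real set \<times> (real \<Rightarrow> plane)) set" where
  "trajectories U Z V = maximal_curves (trajectory_germ U Z) V"

definition integral_curves ::
  "field2 \<Rightarrow> plane set \<Rightarrow> (real set \<times> (real \<Rightarrow> plane)) set" where
  "integral_curves F V = maximal_curves (smooth_germ F) V"


subsection \<open>Equivalence\<close>

definition to_complex :: "plane \<Rightarrow> complex" where
  "to_complex p = Complex (p$1) (p$2)"

definition of_complex_plane :: "complex \<Rightarrow> plane" where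
  "of_complex_plane z = vector [Re z, Im z]"

text \<open>For an injective continuous map on an open planar set: local degree \<open>1\<close> at every point,
  measured by the winding number of the image of a circle.\<close>

definition orientation_preserving_on :: "plane set \<Rightarrow> (plane \<Rightarrow> plane) \<Rightarrow> bool" where
  "orientation_preserving_on V h \<longleftrightarrow> (\<forall>p\<in>V. \<forall>\<rho>>0. cball p \<rho> \<subseteq> V \<longrightarrow>
     winding_number (\<lambda>t. to_complex (h (of_complex_plane (circlepath (to_complex p) \<rho> t))))
       (to_complex (h p)) = 1)"

text \<open>\<open>h\<close> carries every curve of \<open>T\<close> onto a curve of \<open>T'\<close>, up to an increasing change of time.\<close>

definition maps_curves :: "(plane \<Rightarrow> plane) \<Rightarrow> (real set \<times> (real \<Rightarrow> plane)) set \<Rightarrow>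
    (real set \<times> (real \<Rightarrow> plane)) set \<Rightarrow> bool" where
  "maps_curves h T T' \<longleftrightarrow> (\<forall>(I, \<gamma>) \<in> T. \<exists>(J, \<delta>) \<in> T'. \<exists>\<tau> :: real \<Rightarrow> real.
     strict_mono_on I \<tau> \<and> \<tau> ` I = J \<and> (\<forall>t\<in>I. h (\<gamma> t) = \<delta> (\<tau> t)))"

definition equivalence_via :: "plane set \<Rightarrow> plane set \<Rightarrow> (plane \<Rightarrow> plane) \<Rightarrow>
    (real set \<times> (real \<Rightarrow> plane)) set \<Rightarrow> (real set \<times> (real \<Rightarrow> plane)) set \<Rightarrow> bool" where
  "equivalence_via V V' h T T' \<longleftrightarrow> (\<exists>h'. homeomorphism V V' h h' \<and>
     orientation_preserving_on V h \<and> maps_curves h T T' \<and> maps_curves h' T' T)"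

definition locally_Sigma_equivalent ::
  "nat \<Rightarrow> plane set \<Rightarrow> field2 \<times> field2 \<Rightarrow> field2 \<times> field2 \<Rightarrow> bool" where
  "locally_Sigma_equivalent r U Z Z' \<longleftrightarrow> Z \<in> Omega r U \<and> Z' \<in> Omega r U \<and>
     (\<exists>V V' h. open V \<and> 0 \<in> V \<and> V \<subseteq> U \<and> open V' \<and> 0 \<in> V' \<and> V' \<subseteq> U \<and>
        equivalence_via V V' h (trajectories U Z V) (trajectories U Z' V') \<and>
        h ` (Sig U \<inter> V) = Sig U \<inter> V')"

text \<open>Local equivalence of a piecewise smooth field with an ordinary continuous one, whose
  trajectories are its integral curves.\<close>

definition locally_C0_equivalent ::
  "plane set \<Rightarrow> field2 \<times> field2 \<Rightarrow> field2 \<Rightarrow> bool" where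
  "locally_C0_equivalent U Z F \<longleftrightarrow>
     (\<exists>V V' h. open V \<and> 0 \<in> V \<and> V \<subseteq> U \<and> open V' \<and> 0 \<in> V' \<and> V' \<subseteq> U \<and>
        equivalence_via V V' h (trajectories U Z V) (integral_curves F V'))"

end

theory Submission
  imports Defs
begin

text \<open>
  Write \<open>v = (a, b)\<close>.  Near the origin both fields point into the open quadrant of \<open>v\<close>.  Hence every axis
  point there is a crossing point, and each trajectory moves monotonically in both coordinates and meets
  each axis at most once.  The equivalence \<open>h\<close> sends \<open>p\<close> to the point whose \<open>i\<close>-th coordinate is \<open>v $ i\<close>
  times the signed time elapsed since the trajectory through \<open>p\<close> crossed the axis \<open>x $ i = 0\<close>.  Both
  times advance at unit rate along a trajectory, so \<open>h\<close> carries trajectories to straight lines traversed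
  with velocity \<open>v\<close>, even without a change of time.  Moreover \<open>h p $ i\<close> has the same sign as \<open>p $ i\<close>,
  so \<open>h\<close> preserves the two axes and all quadrants.

  What has to be shown is that \<open>h\<close> is continuous and injective; invariance of domain then makes
  it a homeomorphism onto an open set.  For a single smooth field the crossing times come from a flow
  box that is a small Lipschitz perturbation of a linear map (\<open>flow_box_time\<close>,
  \<open>exists_time_chart\<close>).  For the piecewise smooth field the crossing times of one field are transported
  along the other to the nearest axis (\<open>glue_time_charts\<close>).

  Given \<open>h\<close>, a germ is a trajectory germ if and only if its image under \<open>h\<close> moves uniformly with velocity
  \<open>v\<close> (\<open>trajectory_germ_iff_straight\<close>).  The same description with the identity in place of \<open>h\<close> holds for
  the constant piecewise field and for its integral curves, so maximal curves correspond to maximal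
  curves (\<open>maps_maximal_curves\<close>).  Finally, a continuous injective map of a disc that preserves
  the signs of the coordinates preserves the orientation (\<open>orientation_preserving_if_sgn\<close>).
\<close>

section \<open>Solutions of planar ordinary differential equations\<close>

lemma symmetric_interval_min:
  fixes s :: real
  assumes "s \<in> {-min d e<..<min d e}"
  shows "s \<in> {-d<..<d}" "s \<in> {-e<..<e}"
  using assms by (auto simp: min_def split: if_splits)

lemma solves_subset: "solves F J g \<Longrightarrow> K \<subseteq> J \<Longrightarrow> solves F K g"
  unfolding solves_def by (auto intro: has_vector_derivative_within_subset)

lemma solves_cong:
  assumes "solves F J g" "\<And>s. s \<in> J \<Longrightarrow> f s = g s"
  shows "solves F J f"
  unfolding solves_def
proof
  fix s assume "s \<in> J"
  have "(g has_vector_derivative F (g s)) (at s within J)"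
    using assms(1) \<open>s \<in> J\<close> by (simp add: solves_def)
  then show "(f has_vector_derivative F (f s)) (at s within J)"
    using has_vector_derivative_transform[OF \<open>s \<in> J\<close> assms(2)] assms(2)[OF \<open>s \<in> J\<close>] by simp
qed

lemma solves_continuous_on: "solves F J g \<Longrightarrow> continuous_on J g"
  unfolding solves_def continuous_on_eq_continuous_within
  by (auto intro: has_vector_derivative_continuous)

lemma solves_open_iff:
  assumes "open J"
  shows "solves F J g \<longleftrightarrow> (\<forall>s\<in>J. (g has_vector_derivative F (g s)) (at s))"
  unfolding solves_def by (rule ball_cong) (simp_all only: at_within_open[OF _ assms])

lemma vector_mean_value_bound:
  fixes f :: "real \<Rightarrow> 'a::real_normed_vector"
  assumes "convex K"
    and d: "\<And>t. t \<in> K \<Longrightarrow> (f has_vector_derivative f' t) (at t within K)"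
    and B: "\<And>t. t \<in> K \<Longrightarrow> norm (f' t) \<le> B"
    and "x \<in> K" "y \<in> K"
  shows "norm (f x - f y) \<le> B * \<bar>x - y\<bar>"
proof -
  have "norm (f x - f y) \<le> B * norm (x - y)"
  proof (rule differentiable_bound[OF assms(1) _ _ assms(4,5)])
    show "(f has_derivative (\<lambda>h. h *\<^sub>R f' t)) (at t within K)" if "t \<in> K" for t
      using d[OF that] by (simp add: has_vector_derivative_def)
    show "onorm (\<lambda>h. h *\<^sub>R f' t) \<le> B" if "t \<in> K" for t
    proof (rule onorm_le)
      show "norm (h *\<^sub>R f' t) \<le> B * norm h" for h :: real
        using mult_left_mono[OF B[OF that] abs_ge_zero[of h]] by (simp add: mult.commute)
    qed
  qed
  then show ?thesis by simp
qed

text \<open>The Picard operator acts on bounded continuous functions on the whole line.  To stay in that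
  complete space, time is clamped to \<open>[-S, S]\<close>; the clamp is invisible inside the interval, where
  the fixed point solves the equation.\<close>

lemma picard_exists:
  fixes F :: field2
  assumes lip: "\<And>x y. norm (F x - F y) \<le> L * norm (x - y)"
    and "0 \<le> L" "0 < S" and LS: "L * S \<le> 1/2"
  shows "\<exists>g. g 0 = p \<and> solves F {-S..S} g"
proof -
  \<comment> \<open>The integral from \<open>0\<close> to \<open>t\<close>, written with lower end \<open>-S\<close> so that it also makes sense for \<open>t < 0\<close>.\<close>
  define I where "I \<phi> t = p + (integral {-S..t} (\<lambda>s. F (\<phi> s)) - integral {-S..0} (\<lambda>s. F (\<phi> s)))"
    for \<phi> :: "real \<Rightarrow> plane" and t
  have contF: "continuous_on UNIV F"
    by (rule lipschitz_on_continuous_on[of L], rule lipschitz_onI)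
       (use assms in \<open>auto simp: dist_norm\<close>)
  have dI: "(I \<phi> has_vector_derivative F (\<phi> t)) (at t within {-S..S})"
    if c: "continuous_on UNIV \<phi>" and t: "t \<in> {-S..S}" for \<phi> t
  proof -
    have "continuous_on {-S..S} (\<lambda>s. F (\<phi> s))"
      by (rule continuous_on_compose2[OF contF continuous_on_subset[OF c]]) auto
    from integral_has_vector_derivative[OF this t]
    have "((\<lambda>t. p + (integral {-S..t} (\<lambda>s. F (\<phi> s)) - integral {-S..0} (\<lambda>s. F (\<phi> s))))
            has_vector_derivative 0 + (F (\<phi> t) - 0)) (at t within {-S..S})"
      by (intro has_vector_derivative_add has_vector_derivative_diff has_vector_derivative_const)
    then show ?thesis unfolding I_def by simp
  qed
  have I0: "I \<phi> 0 = p" for \<phi> by (simp add: I_def)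
  define c where "c t = max (-S) (min S t)" for t
  have c_in: "c t \<in> {-S..S}" for t using \<open>0 < S\<close> by (auto simp: c_def)
  have c_cont: "continuous_on UNIV c" unfolding c_def by (intro continuous_intros)
  have Icont: "continuous_on {-S..S} (I \<phi>)" if "continuous_on UNIV \<phi>" for \<phi>
    unfolding continuous_on_eq_continuous_within
    by (auto intro: has_vector_derivative_continuous dI[OF that])
  define T where "T \<phi> = Bcontfun (\<lambda>t. I (apply_bcontfun \<phi>) (c t))" for \<phi> :: "real \<Rightarrow>\<^sub>C plane"
  have T: "apply_bcontfun (T \<phi>) = (\<lambda>t. I (apply_bcontfun \<phi>) (c t))" for \<phi>
    unfolding T_def
  proof (rule Bcontfun_inverse)
    have "continuous_on UNIV (\<lambda>t. I (apply_bcontfun \<phi>) (c t))"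
      by (rule continuous_on_compose2[OF Icont c_cont]) (use c_in in auto)
    moreover have "bounded (I (apply_bcontfun \<phi>) ` {-S..S})"
      by (intro compact_imp_bounded compact_continuous_image Icont) auto
    then have "bounded (range (\<lambda>t. I (apply_bcontfun \<phi>) (c t)))"
      by (rule bounded_subset) (use c_in in auto)
    ultimately show "(\<lambda>t. I (apply_bcontfun \<phi>) (c t)) \<in> bcontfun"
      by (simp add: bcontfun_def)
  qed
  have "dist (T \<phi>) (T \<psi>) \<le> 1/2 * dist \<phi> \<psi>" for \<phi> \<psi>
  proof (rule dist_bound)
    fix t
    let ?D = "\<lambda>t. I (apply_bcontfun \<phi>) t - I (apply_bcontfun \<psi>) t"
    have "norm (?D (c t) - ?D 0) \<le> (L * dist \<phi> \<psi>) * \<bar>c t - 0\<bar>"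
    proof (rule vector_mean_value_bound)
      show "convex {-S..S}" by simp
      show "(?D has_vector_derivative F (\<phi> t) - F (\<psi> t)) (at t within {-S..S})"
        if "t \<in> {-S..S}" for t
        by (intro has_vector_derivative_diff dI that) auto
      show "norm (F (\<phi> t) - F (\<psi> t)) \<le> L * dist \<phi> \<psi>" for t
        using lip[of "\<phi> t" "\<psi> t"] mult_left_mono[OF dist_bounded[of \<phi> t \<psi>] \<open>0 \<le> L\<close>]
        by (simp add: dist_norm)
    qed (use c_in \<open>0 < S\<close> in auto)
    also have "\<dots> \<le> (L * dist \<phi> \<psi>) * S"
      by (rule mult_left_mono) (use c_in[of t] \<open>0 \<le> L\<close> in auto)
    also have "\<dots> \<le> 1/2 * dist \<phi> \<psi>"
      using mult_right_mono[OF LS, of "dist \<phi> \<psi>"] by (simp add: mult_ac)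
    finally show "dist (T \<phi> t) (T \<psi> t) \<le> 1/2 * dist \<phi> \<psi>"
      by (simp add: T I0 dist_norm)
  qed
  then have "\<exists>!\<phi>. T \<phi> = \<phi>" by (intro banach_fix_type[of "1/2"]) auto
  then obtain \<phi> where \<phi>: "T \<phi> = \<phi>" by blast
  have eq: "\<phi> t = I (apply_bcontfun \<phi>) t" if "t \<in> {-S..S}" for t
  proof -
    have "c t = t" using that by (auto simp: c_def)
    then show ?thesis using fun_cong[OF T[of \<phi>], of t] unfolding \<phi> by simp
  qed
  show ?thesis
  proof (intro exI conjI)
    show "I (apply_bcontfun \<phi>) 0 = p" by (rule I0)
    show "solves F {-S..S} (I (apply_bcontfun \<phi>))"
      unfolding solves_def using dI[of \<phi>] eq by auto
  qed
qed

text \<open>At a time \<open>m\<close> where the distance of two solutions is largest, that distance exceeds the initial one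
  by at most \<open>L e\<close> times itself, and \<open>L e \<le> 1/2\<close>.  With equal initial values this is uniqueness.\<close>

lemma solutions_diverge_slowly:
  fixes F :: field2
  assumes lip: "\<And>x y. norm (F x - F y) \<le> L * norm (x - y)"
    and "0 \<le> L" "0 \<le> e" and Le: "L * e \<le> 1/2"
    and f: "solves F {-e..e} f" and g: "solves F {-e..e} g" and t: "t \<in> {-e..e}"
  shows "norm (f t - g t) \<le> 2 * norm (f 0 - g 0)"
proof -
  have "continuous_on {-e..e} (\<lambda>s. norm (f s - g s))"
    by (intro continuous_intros solves_continuous_on[OF f] solves_continuous_on[OF g])
  moreover have "{-e..e} \<noteq> {}" using \<open>0 \<le> e\<close> by auto
  ultimately obtain m where m: "m \<in> {-e..e}" "\<And>s. s \<in> {-e..e} \<Longrightarrow> norm (f s - g s) \<le> norm (f m - g m)"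
    using continuous_attains_sup[of "{-e..e}" "\<lambda>s. norm (f s - g s)"] by auto
  let ?M = "norm (f m - g m)"
  have "norm ((f m - g m) - (f 0 - g 0)) \<le> (L * ?M) * \<bar>m - 0\<bar>"
  proof (rule vector_mean_value_bound[where f="\<lambda>s. f s - g s" and K="{-e..e}"])
    show "((\<lambda>s. f s - g s) has_vector_derivative F (f s) - F (g s)) (at s within {-e..e})"
      if "s \<in> {-e..e}" for s
      using f g that unfolding solves_def by (intro has_vector_derivative_diff) auto
    show "norm (F (f s) - F (g s)) \<le> L * ?M" if "s \<in> {-e..e}" for s
      using lip[of "f s" "g s"] mult_left_mono[OF m(2)[OF that] \<open>0 \<le> L\<close>] by linarith
  qed (use m \<open>0 \<le> e\<close> in auto)
  also have "\<dots> \<le> (L * ?M) * e"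
    by (rule mult_left_mono) (use m(1) \<open>0 \<le> L\<close> in auto)
  also have "\<dots> \<le> 1/2 * ?M"
    using mult_right_mono[OF Le, of ?M] by (simp add: mult_ac)
  finally have "norm ((f m - g m) - (f 0 - g 0)) \<le> 1/2 * ?M" .
  moreover have "?M \<le> norm ((f m - g m) - (f 0 - g 0)) + norm (f 0 - g 0)"
    using norm_triangle_ineq[of "(f m - g m) - (f 0 - g 0)" "f 0 - g 0"] by simp
  ultimately have "?M \<le> 2 * norm (f 0 - g 0)" by linarith
  with m(2)[OF t] show ?thesis by linarith
qed


section \<open>Flow boxes as perturbations of linear maps\<close>

lemma solves_shift:
  assumes "solves F K f" "\<And>s. s \<in> J \<Longrightarrow> c + s \<in> K"
  shows "solves F J (\<lambda>s. f (c + s))"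
  unfolding solves_def
proof
  fix s assume s: "s \<in> J"
  have "(+) c ` J \<subseteq> K" using assms(2) by auto
  then have "solves F ((+) c ` J) f" by (rule solves_subset[OF assms(1)])
  then have "(f has_vector_derivative F (f (c + s))) (at (c + s) within (+) c ` J)"
    using s by (simp add: solves_def)
  moreover have "((+) c has_vector_derivative 1) (at s within J)"
    by (auto intro!: derivative_eq_intros)
  ultimately have "(f \<circ> (+) c has_vector_derivative 1 *\<^sub>R F (f (c + s))) (at s within J)"
    by (intro vector_diff_chain_within) auto
  then show "((\<lambda>s. f (c + s)) has_vector_derivative F (f (c + s))) (at s within J)"
    by (simp add: o_def)
qed

lemma smooth_germ_continuous_near:
  assumes "smooth_germ F g" "open N" "g 0 \<in> N"
  shows "\<exists>e>0. \<forall>s\<in>{-e<..<e}. g s \<in> N"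
proof -
  obtain e where e: "e > 0" "solves F {-e<..<e} g" using assms(1) by (auto simp: smooth_germ_def)
  have "isCont g 0"
    using solves_continuous_on[OF e(2)] \<open>e > 0\<close>
    by (auto simp: continuous_on_eq_continuous_at)
  then have "\<forall>\<^sub>F s in at 0. g s \<in> N"
    using assms by (auto simp: isCont_def intro: topological_tendstoD)
  then obtain d where "d > 0" "\<And>s. s \<noteq> 0 \<Longrightarrow> dist s 0 < d \<Longrightarrow> g s \<in> N"
    by (auto simp: eventually_at)
  then show ?thesis
    using assms(3) by (intro exI[of _ d]) (metis abs_less_iff dist_norm diff_zero greaterThanLessThan_iff
        real_norm_def minus_less_iff)
qed

lemma norm_axis: "norm (axis i c :: real^'n) = \<bar>c\<bar>"
  by (simp add: norm_eq_sqrt_inner inner_axis_axis)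

text \<open>Let \<open>\<Psi> x\<close> be the point reached at time \<open>x $ i\<close> by the solution that starts at the projection of
  \<open>x\<close> to the axis \<open>x $ i = 0\<close>.  For the constant field \<open>v\<close> this is the linear isomorphism \<open>M\<close>; in
  general it is \<open>M\<close> plus a map with a small Lipschitz constant, hence injective, and its image is open
  by invariance of domain.  The \<open>i\<close>-th coordinate \<open>T\<close> of the inverse is the signed time since the
  solution crossed the axis.  The estimate on \<open>T\<close>, which says that \<open>v $ i * T\<close> is close to the \<open>i\<close>-th
  coordinate, lets the two times for \<open>i = 1, 2\<close> be combined into an injective map.\<close>

lemma flow_box_time:
  fixes F :: field2 and v :: plane
  assumes lip: "\<And>x y. norm (F x - F y) \<le> L * norm (x - y)"
    and dev: "\<And>x. norm (F x - v) \<le> \<eta>"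
    and "0 \<le> L" "0 < S" and LS: "L * S \<le> 1/2" and vi: "v $ i \<noteq> 0"
    and small: "(1 + (1 + norm v) / \<bar>v $ i\<bar>) * (\<eta> + 2 * L * S) \<le> 1/8"
  shows "\<exists>N T. open N \<and> 0 \<in> N \<and>
    (\<forall>p\<in>N. \<forall>q\<in>N. \<bar>v $ i * (T p - T q) - (p $ i - q $ i)\<bar> \<le> norm (p - q) / 4) \<and>
    (\<forall>p\<in>ball 0 S. p $ i = 0 \<longrightarrow> p \<in> N \<and> T p = 0) \<and>
    (\<forall>g. g 0 \<in> N \<and> smooth_germ F g \<longrightarrow> (\<exists>e>0. \<forall>s\<in>{-e<..<e}. g s \<in> N \<and> T (g s) = T (g 0) + s))"
proof -
  obtain \<Phi> where \<Phi>0: "\<And>p. \<Phi> p 0 = p" and \<Phi>: "\<And>p. solves F {-S..S} (\<Phi> p)"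
    using picard_exists[OF lip \<open>0 \<le> L\<close> \<open>0 < S\<close> LS] by metis
  \<comment> \<open>\<open>\<kappa>\<close> bounds the Lipschitz constant of \<open>\<Psi> - M\<close>, and \<open>K\<close> the norm of the inverse of \<open>M\<close>.\<close>
  define \<kappa> where "\<kappa> = \<eta> + 2 * L * S"
  define K where "K = 1 + (1 + norm v) / \<bar>v $ i\<bar>"
  have "\<eta> \<ge> 0" using dev[of 0] norm_ge_zero order_trans by blast
  then have "\<kappa> \<ge> 0" using \<open>0 \<le> L\<close> \<open>0 < S\<close> by (simp add: \<kappa>_def)
  have "K \<ge> 1" by (simp add: K_def)
  have K\<kappa>: "K * \<kappa> \<le> 1/8" using small by (simp add: K_def \<kappa>_def)
  define hyp where "hyp x = x - axis i (x $ i)" for x :: plane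
  define M where "M z = hyp z + (z $ i) *\<^sub>R v" for z :: plane
  define B where "B = ball (0::plane) S"
  define \<Psi> where "\<Psi> x = \<Phi> (hyp x) (x $ i)" for x
  have hyp_diff: "hyp x - hyp y = hyp (x - y)" for x y
    by (simp add: hyp_def vec_eq_iff axis_def)
  have hyp_norm: "norm (hyp x) \<le> norm x" for x
    by (rule norm_le_componentwise_cart) (simp add: hyp_def axis_def)
  have B_time: "x $ i \<in> {-S..S}" "x $ i \<in> {-S<..<S}" if "x \<in> B" for x
    using that component_le_norm_cart[of x i] by (auto simp: B_def)
  have E1: "norm (\<Phi> p t - \<Phi> p t' - (t - t') *\<^sub>R v) \<le> \<eta> * \<bar>t - t'\<bar>"
    if "t \<in> {-S..S}" "t' \<in> {-S..S}" for p t t'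
  proof -
    have "norm ((\<Phi> p t - t *\<^sub>R v) - (\<Phi> p t' - t' *\<^sub>R v)) \<le> \<eta> * \<bar>t - t'\<bar>"
    proof (rule vector_mean_value_bound[where f="\<lambda>t. \<Phi> p t - t *\<^sub>R v" and K="{-S..S}"])
      show "((\<lambda>t. \<Phi> p t - t *\<^sub>R v) has_vector_derivative F (\<Phi> p s) - v) (at s within {-S..S})"
        if "s \<in> {-S..S}" for s
        using \<Phi>[of p] that unfolding solves_def
        by (intro has_vector_derivative_diff) (auto intro!: derivative_eq_intros)
    qed (use that dev in auto)
    then show ?thesis by (simp add: algebra_simps)
  qed
  have E2: "norm ((\<Phi> p t - \<Phi> q t) - (p - q)) \<le> 2 * L * S * norm (p - q)"
    if "t \<in> {-S..S}" for p q t
  proof -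
    have "norm ((\<Phi> p t - \<Phi> q t) - (\<Phi> p 0 - \<Phi> q 0)) \<le> (L * (2 * norm (p - q))) * \<bar>t - 0\<bar>"
    proof (rule vector_mean_value_bound[where f="\<lambda>t. \<Phi> p t - \<Phi> q t" and K="{-S..S}"])
      show "((\<lambda>t. \<Phi> p t - \<Phi> q t) has_vector_derivative F (\<Phi> p s) - F (\<Phi> q s)) (at s within {-S..S})"
        if "s \<in> {-S..S}" for s
        using \<Phi> that unfolding solves_def by (intro has_vector_derivative_diff) auto
      show "norm (F (\<Phi> p s) - F (\<Phi> q s)) \<le> L * (2 * norm (p - q))" if s: "s \<in> {-S..S}" for s
      proof -
        have "norm (\<Phi> p s - \<Phi> q s) \<le> 2 * norm (p - q)"
          using solutions_diverge_slowly[OF lip \<open>0 \<le> L\<close> _ LS \<Phi> \<Phi> s, of p q] \<open>0 < S\<close> \<Phi>0 by simp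
        from mult_left_mono[OF this \<open>0 \<le> L\<close>] show ?thesis using lip[of "\<Phi> p s" "\<Phi> q s"] by linarith
      qed
    qed (use that \<open>0 < S\<close> in auto)
    also have "\<dots> \<le> (L * (2 * norm (p - q))) * S"
      by (rule mult_left_mono) (use that \<open>0 \<le> L\<close> in auto)
    finally show ?thesis by (simp add: \<Phi>0 mult_ac)
  qed
  have almost_linear: "norm (\<Psi> x - \<Psi> y - M (x - y)) \<le> \<kappa> * norm (x - y)" if "x \<in> B" "y \<in> B" for x y
  proof -
    have "\<Psi> x - \<Psi> y - M (x - y) = (\<Phi> (hyp x) (x $ i) - \<Phi> (hyp x) (y $ i) - (x $ i - y $ i) *\<^sub>R v)
        + ((\<Phi> (hyp x) (y $ i) - \<Phi> (hyp y) (y $ i)) - (hyp x - hyp y))"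
      by (simp add: \<Psi>_def M_def hyp_diff)
    then have "norm (\<Psi> x - \<Psi> y - M (x - y)) \<le> \<eta> * \<bar>x $ i - y $ i\<bar> + 2 * L * S * norm (hyp x - hyp y)"
      using norm_triangle_le[OF add_mono[OF E1 E2]] B_time[OF that(1)] B_time[OF that(2)] by metis
    also have "\<dots> \<le> \<eta> * norm (x - y) + 2 * L * S * norm (x - y)"
      using hyp_norm[of "x - y"] component_le_norm_cart[of "x - y" i] \<open>\<eta> \<ge> 0\<close> \<open>0 \<le> L\<close> \<open>0 < S\<close>
      by (intro add_mono mult_left_mono) (simp_all add: hyp_diff)
    finally show ?thesis by (simp add: \<kappa>_def algebra_simps)
  qed
  have M_i: "M z $ i = z $ i * v $ i" for z by (simp add: M_def hyp_def axis_def)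
  have M_bound: "norm z \<le> K * norm (M z)" for z
  proof -
    have "z = M z + (axis i (z $ i) - (z $ i) *\<^sub>R v)" by (simp add: M_def hyp_def)
    then have "norm z \<le> norm (M z) + norm (axis i (z $ i) - (z $ i) *\<^sub>R v)"
      by (metis norm_triangle_ineq)
    also have "norm (axis i (z $ i) - (z $ i) *\<^sub>R v) \<le> \<bar>z $ i\<bar> + \<bar>z $ i\<bar> * norm v"
      by (rule order_trans[OF norm_triangle_ineq4]) (simp add: norm_axis)
    also have "\<bar>z $ i\<bar> + \<bar>z $ i\<bar> * norm v = \<bar>M z $ i\<bar> * ((1 + norm v) / \<bar>v $ i\<bar>)"
      using vi by (simp add: M_i abs_mult field_simps)
    also have "\<dots> \<le> norm (M z) * ((1 + norm v) / \<bar>v $ i\<bar>)"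
      by (intro mult_right_mono component_le_norm_cart) auto
    finally show ?thesis by (simp add: K_def algebra_simps)
  qed
  have expand: "norm (x - y) \<le> 2 * K * norm (\<Psi> x - \<Psi> y)" if "x \<in> B" "y \<in> B" for x y
  proof -
    have "norm (M (x - y)) \<le> norm (\<Psi> x - \<Psi> y) + \<kappa> * norm (x - y)"
      using almost_linear[OF that] norm_triangle_ineq4[of "\<Psi> x - \<Psi> y" "\<Psi> x - \<Psi> y - M (x - y)"] by simp
    then have "K * norm (M (x - y)) \<le> K * norm (\<Psi> x - \<Psi> y) + (K * \<kappa>) * norm (x - y)"
      using mult_left_mono[of _ _ K] \<open>K \<ge> 1\<close> by (fastforce simp: algebra_simps)
    moreover have "(K * \<kappa>) * norm (x - y) \<le> 1/8 * norm (x - y)"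
      by (rule mult_right_mono[OF K\<kappa>]) simp
    ultimately have "norm (x - y) \<le> K * norm (\<Psi> x - \<Psi> y) + 1/8 * norm (x - y)"
      using M_bound[of "x - y"] by linarith
    then show ?thesis using norm_ge_zero[of "x - y"] unfolding mult.assoc by linarith
  qed
  have inj: "inj_on \<Psi> B"
  proof (rule inj_onI)
    fix x y assume "x \<in> B" "y \<in> B" "\<Psi> x = \<Psi> y"
    with expand[of x y] show "x = y" by simp
  qed
  have cont: "continuous_on B \<Psi>"
  proof (rule lipschitz_on_continuous_on[of "\<kappa> + (2 + norm v)"], rule lipschitz_onI)
    fix x y assume xy: "x \<in> B" "y \<in> B"
    have "norm (M (x - y)) \<le> norm (x - y) + norm (x - y) * norm v"
      unfolding M_def
      by (intro norm_triangle_le add_mono hyp_norm)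
         (use component_le_norm_cart[of "x - y" i] in \<open>auto intro!: mult_right_mono\<close>)
    then have "norm (\<Psi> x - \<Psi> y) \<le> (\<kappa> + (1 + norm v)) * norm (x - y)"
      using almost_linear[OF xy] norm_triangle_sub[of "\<Psi> x - \<Psi> y" "M (x - y)"]
      by (simp add: algebra_simps)
    also have "\<dots> \<le> (\<kappa> + (2 + norm v)) * norm (x - y)" by (rule mult_right_mono) auto
    finally show "dist (\<Psi> x) (\<Psi> y) \<le> (\<kappa> + (2 + norm v)) * dist x y" by (simp add: dist_norm)
  qed (use \<open>\<kappa> \<ge> 0\<close> in simp)
  define N where "N = \<Psi> ` B"
  have "open N" unfolding N_def using cont inj by (intro invariance_of_domain) (auto simp: B_def)
  define T where "T p = inv_into B \<Psi> p $ i" for p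
  have T: "T (\<Psi> x) = x $ i" if "x \<in> B" for x using that inj by (simp add: T_def)
  have on_axis: "p \<in> N \<and> T p = 0" if "p \<in> ball 0 S" "p $ i = 0" for p
  proof -
    have "\<Psi> p = p" using that by (simp add: \<Psi>_def hyp_def \<Phi>0 axis_def vec_eq_iff)
    then show ?thesis using T[of p] that unfolding N_def B_def by (metis image_eqI)
  qed
  have est: "\<bar>v $ i * (T p - T q) - (p $ i - q $ i)\<bar> \<le> norm (p - q) / 4" if pq: "p \<in> N" "q \<in> N" for p q
  proof -
    obtain x y where xy: "x \<in> B" "y \<in> B" "p = \<Psi> x" "q = \<Psi> y" using pq by (auto simp: N_def)
    have "\<bar>v $ i * (T p - T q) - (p $ i - q $ i)\<bar> = \<bar>(\<Psi> x - \<Psi> y - M (x - y)) $ i\<bar>"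
      using xy by (simp add: T M_i abs_minus_commute algebra_simps)
    also have "\<dots> \<le> norm (\<Psi> x - \<Psi> y - M (x - y))" by (rule component_le_norm_cart)
    also have "\<dots> \<le> \<kappa> * norm (x - y)" by (rule almost_linear[OF xy(1,2)])
    also have "\<dots> \<le> \<kappa> * (2 * K * norm (\<Psi> x - \<Psi> y))"
      by (rule mult_left_mono[OF expand[OF xy(1,2)] \<open>\<kappa> \<ge> 0\<close>])
    also have "\<dots> = 2 * (K * \<kappa>) * norm (\<Psi> x - \<Psi> y)" by (simp add: mult_ac)
    also have "\<dots> \<le> 2 * (1/8) * norm (\<Psi> x - \<Psi> y)"
      by (intro mult_right_mono mult_left_mono K\<kappa>) auto
    finally show ?thesis using xy by simp
  qed
  have along: "\<exists>e>0. \<forall>s\<in>{-e<..<e}. g s \<in> N \<and> T (g s) = T (g 0) + s"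
    if g: "g 0 \<in> N" "smooth_germ F g" for g
  proof -
    obtain x where x: "x \<in> B" "g 0 = \<Psi> x" using g by (auto simp: N_def)
    obtain d where d: "d > 0" "solves F {-d<..<d} g" using g by (auto simp: smooth_germ_def)
    \<comment> \<open>Short enough for \<open>x + axis i s\<close> to stay in \<open>B\<close> when \<open>\<bar>s\<bar> \<le> e\<close>.\<close>
    define e where "e = min (d/2) ((S - norm x) / 2)"
    have "e > 0" using d x by (simp add: e_def B_def)
    have "S - norm x \<le> 2 * S" using norm_ge_zero[of x] \<open>S > 0\<close> by (smt (verit))
    then have "(S - norm x) / 2 \<le> S" by simp
    then have "e \<le> S" unfolding e_def by (rule min.coboundedI2)
    have "L * e \<le> 1/2" using mult_left_mono[OF \<open>e \<le> S\<close> \<open>0 \<le> L\<close>] LS by linarith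
    have stay: "x + axis i s \<in> B" if "s \<in> {-e..e}" for s
    proof -
      have "\<bar>s\<bar> \<le> e" using that by auto
      then have "\<bar>s\<bar> \<le> (S - norm x) / 2" by (simp add: e_def)
      moreover have "norm x < S" using x by (simp add: B_def)
      ultimately have "norm x + norm (axis i s) < S" by (simp add: norm_axis)
      then show ?thesis using norm_triangle_ineq[of x "axis i s"] by (simp add: B_def)
    qed
    have "hyp (x + axis i s) = hyp x" for s
      by (simp add: hyp_def axis_def vec_eq_iff)
    then have val: "\<Psi> (x + axis i s) = \<Phi> (hyp x) (x $ i + s)" for s
      by (simp add: \<Psi>_def axis_def)
    have "solves F {-e..e} (\<lambda>s. \<Phi> (hyp x) (x $ i + s))"
    proof (rule solves_shift[OF \<Phi>])
      show "x $ i + s \<in> {-S..S}" if "s \<in> {-e..e}" for s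
        using B_time(1)[OF stay[OF that]] by (simp add: axis_def)
    qed
    moreover have "solves F {-e..e} g" by (rule solves_subset[OF d(2)]) (use d in \<open>auto simp: e_def\<close>)
    ultimately have agree: "g s = \<Phi> (hyp x) (x $ i + s)" if "s \<in> {-e..e}" for s
    proof -
      assume sol: "solves F {-e..e} (\<lambda>s. \<Phi> (hyp x) (x $ i + s))" "solves F {-e..e} g"
      have "norm (g s - \<Phi> (hyp x) (x $ i + s)) \<le> 2 * norm (g 0 - \<Phi> (hyp x) (x $ i + 0))"
        using solutions_diverge_slowly[OF lip \<open>0 \<le> L\<close> less_imp_le[OF \<open>e > 0\<close>] \<open>L * e \<le> 1/2\<close>
            sol(2) sol(1) that] .
      then show ?thesis using x(2) by (simp add: \<Psi>_def)
    qed
    show ?thesis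
    proof (intro exI[of _ e] conjI ballI \<open>e > 0\<close>)
      fix s assume "s \<in> {-e<..<e}"
      then have s: "s \<in> {-e..e}" by auto
      have eq: "g s = \<Psi> (x + axis i s)" using agree[OF s] val by simp
      show "g s \<in> N" using stay[OF s] unfolding eq N_def by blast
      show "T (g s) = T (g 0) + s" unfolding eq x(2) T[OF stay[OF s]] T[OF x(1)] by (simp add: axis_def)
    qed
  qed
  have "0 \<in> N" using on_axis[of 0] \<open>0 < S\<close> by simp
  with \<open>open N\<close> est on_axis along show ?thesis
    by (intro exI[of _ N] exI[of _ T] conjI ballI allI impI) auto
qed


section \<open>Crossing times of a smooth field\<close>

text \<open>The \<open>i\<close>-th coordinate of \<open>k p\<close> is the signed time elapsed since the solution of \<open>F\<close> through \<open>p\<close>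
  crossed the axis \<open>x $ i = 0\<close>.  It is described by its effect: both coordinates advance at unit rate
  along solutions, and their signs tell the quadrant.  Local solvability of \<open>F\<close> is part of the notion.\<close>

definition time_chart :: "field2 \<Rightarrow> real \<Rightarrow> (plane \<Rightarrow> plane) \<Rightarrow> bool" where
  "time_chart F \<rho> k \<longleftrightarrow>
     continuous_on (ball 0 \<rho>) k \<and> inj_on k (ball 0 \<rho>) \<and>
     (\<forall>p\<in>ball 0 \<rho>. \<forall>i. sgn (k p $ i) = sgn (F 0 $ i) * sgn (p $ i)) \<and>
     (\<forall>p\<in>ball 0 \<rho>. \<exists>g. g 0 = p \<and> smooth_germ F g) \<and>
     (\<forall>g. g 0 \<in> ball 0 \<rho> \<and> smooth_germ F g \<longrightarrow>
        (\<exists>e>0. \<forall>s\<in>{-e<..<e}. k (g s) = k (g 0) + vec s))"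

lemma time_chart_subset:
  assumes "time_chart F \<rho> k" "\<rho>' \<le> \<rho>"
  shows "time_chart F \<rho>' k"
proof -
  have "ball (0::plane) \<rho>' \<subseteq> ball 0 \<rho>" using assms(2) by (rule subset_ball)
  then show ?thesis
    using assms(1) unfolding time_chart_def
    by (meson continuous_on_subset inj_on_subset subsetD)
qed

lemma smooth_germ_agree:
  assumes "smooth_germ F g" "open N" "g 0 \<in> N" "\<And>p. p \<in> N \<Longrightarrow> G p = F p"
  shows "smooth_germ G g"
proof -
  obtain d where d: "d > 0" "solves F {-d<..<d} g" using assms(1) by (auto simp: smooth_germ_def)
  obtain e where e: "e > 0" "\<forall>s\<in>{-e<..<e}. g s \<in> N"
    using smooth_germ_continuous_near[OF assms(1-3)] by blast
  have "solves F {-min d e<..<min d e} g" by (rule solves_subset[OF d(2)]) auto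
  then have "solves G {-min d e<..<min d e} g"
    unfolding solves_def using e(2) assms(4) by auto
  then show ?thesis using d(1) e(1) unfolding smooth_germ_def by (intro exI[of _ "min d e"]) auto
qed

text \<open>Composing \<open>F\<close> with the projection to a small closed ball makes it globally Lipschitz and uniformly
  close to \<open>F 0\<close>, without changing it near the origin.  The crossing times of both axes then
  form an injective pair, because each of them differs from a multiple of a
  coordinate by a small Lipschitz error.\<close>

lemma exists_time_chart:
  fixes F :: field2
  assumes "0 < R" and lip: "\<And>p q. p \<in> ball 0 R \<Longrightarrow> q \<in> ball 0 R \<Longrightarrow> norm (F p - F q) \<le> L * norm (p - q)"
    and "0 \<le> L" and F0: "\<And>i. F 0 $ i \<noteq> 0"
  shows "\<exists>\<rho>>0. \<exists>k. time_chart F \<rho> k"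
proof -
  define v where "v = F 0"
  define K where "K = 1 + (\<Sum>i\<in>UNIV. (1 + norm v) / \<bar>v $ i\<bar>)"
  have K_ge: "1 + (1 + norm v) / \<bar>v $ i\<bar> \<le> K" for i
  proof -
    have "(1 + norm v) / \<bar>v $ i\<bar> \<le> (\<Sum>i\<in>UNIV. (1 + norm v) / \<bar>v $ i\<bar>)"
      by (rule member_le_sum) auto
    then show ?thesis by (simp add: K_def)
  qed
  have "K \<ge> 1" by (simp add: K_def sum_nonneg)
  \<comment> \<open>\<open>\<eta>\<close> bounds the oscillation of the field and \<open>S\<close> the length of time, so that
    \<open>K * (\<eta> + 2 * L * S)\<close> is at most \<open>1/16 + 1/16\<close>.\<close>
  define \<eta> where "\<eta> = 1 / (16 * K)"
  define r where "r = min (R / 2) (\<eta> / (L + 1))"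
  define S where "S = 1 / (32 * K * (L + 1))"
  have "\<eta> > 0" using \<open>K \<ge> 1\<close> by (simp add: \<eta>_def)
  have "r > 0" using \<open>\<eta> > 0\<close> \<open>0 < R\<close> \<open>0 \<le> L\<close> by (simp add: r_def)
  have "S > 0" using \<open>K \<ge> 1\<close> \<open>0 \<le> L\<close> by (simp add: S_def)
  have "K * S = 1 / (32 * (L + 1))" using \<open>K \<ge> 1\<close> by (simp add: S_def)
  moreover have "K * (2 * L * S) = 2 * L * (K * S)" by (simp only: mult_ac)
  ultimately have "K * (2 * L * S) = 2 * L * (1 / (32 * (L + 1)))" by (simp only:)
  also have "\<dots> \<le> 1/16" using \<open>0 \<le> L\<close> by (simp add: field_simps)
  finally have LS: "K * (2 * L * S) \<le> 1/16" .
  have "1 * (L * S) \<le> K * (L * S)"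
    by (rule mult_right_mono) (use \<open>K \<ge> 1\<close> \<open>0 \<le> L\<close> \<open>S > 0\<close> in auto)
  then have LS': "L * S \<le> 1/2" using LS by simp
  define F' where "F' x = F (closest_point (cball 0 r) x)" for x
  have cp: "closest_point (cball 0 r) x \<in> cball 0 r" for x :: plane
    using \<open>r > 0\<close> by (intro closest_point_in_set) auto
  have cb: "cball 0 r \<subseteq> ball (0::plane) R" using \<open>0 < R\<close> by (auto simp: r_def)
  have lip': "norm (F' x - F' y) \<le> L * norm (x - y)" for x y
  proof -
    have "norm (F' x - F' y) \<le> L * norm (closest_point (cball 0 r) x - closest_point (cball 0 r) y)"
      unfolding F'_def using cp cb by (intro lip) blast+
    also have "\<dots> \<le> L * norm (x - y)"
      using closest_point_lipschitz[of "cball (0::plane) r" x y] \<open>r > 0\<close> \<open>0 \<le> L\<close>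
      by (intro mult_left_mono) (auto simp: dist_norm)
    finally show ?thesis .
  qed
  have dev: "norm (F' x - v) \<le> \<eta>" for x
  proof -
    have "norm (F' x - v) \<le> L * norm (closest_point (cball 0 r) x - 0)"
      unfolding F'_def v_def using subsetD[OF cb cp] \<open>0 < R\<close> by (intro lip) auto
    also have "\<dots> \<le> L * (\<eta> / (L + 1))"
      using cp[of x] \<open>0 \<le> L\<close> by (intro mult_left_mono) (auto simp: r_def)
    also have "\<dots> \<le> \<eta>" using \<open>\<eta> > 0\<close> \<open>0 \<le> L\<close> by (simp add: field_simps)
    finally show ?thesis .
  qed
  have agree: "F' p = F p" if "p \<in> ball 0 r" for p
    using that by (simp add: F'_def closest_point_self)
  have small: "(1 + (1 + norm v) / \<bar>v $ i\<bar>) * (\<eta> + 2 * L * S) \<le> 1/8" for i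
  proof -
    have "(1 + (1 + norm v) / \<bar>v $ i\<bar>) * (\<eta> + 2 * L * S) \<le> K * (\<eta> + 2 * L * S)"
      using K_ge \<open>\<eta> > 0\<close> \<open>0 \<le> L\<close> \<open>S > 0\<close> by (intro mult_right_mono) auto
    also have "\<dots> = K * \<eta> + K * (2 * L * S)" by (simp add: algebra_simps)
    also have "\<dots> \<le> 1/16 + 1/16" using LS \<open>K \<ge> 1\<close> by (simp add: \<eta>_def)
    finally show ?thesis by simp
  qed
  define box where "box i N T \<longleftrightarrow> open N \<and> 0 \<in> N \<and>
    (\<forall>p\<in>N. \<forall>q\<in>N. \<bar>v $ i * (T p - T q) - (p $ i - q $ i)\<bar> \<le> norm (p - q) / 4) \<and>
    (\<forall>p\<in>ball 0 S. p $ i = 0 \<longrightarrow> p \<in> N \<and> T p = 0) \<and>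
    (\<forall>g. g 0 \<in> N \<and> smooth_germ F' g \<longrightarrow> (\<exists>e>0. \<forall>s\<in>{-e<..<e}. g s \<in> N \<and> T (g s) = T (g 0) + s))"
    for i N T
  have "v $ i \<noteq> 0" for i using F0 by (simp add: v_def)
  then have "\<forall>i. \<exists>N T. box i N T"
    unfolding box_def using flow_box_time[OF lip' dev \<open>0 \<le> L\<close> \<open>0 < S\<close> LS' _ small] by blast
  then obtain N T where box: "\<And>i. box i (N i) (T i)" by metis
  note box = box[unfolded box_def]
  have opN: "open (N i)" and N0: "0 \<in> N i" for i using box by auto
  have est: "\<bar>v $ i * (T i p - T i q) - (p $ i - q $ i)\<bar> \<le> norm (p - q) / 4"
    if "p \<in> N i" "q \<in> N i" for i p q using box[of i] that by auto
  have ax: "T i p = 0" if "p \<in> ball 0 S" "p $ i = 0" for i p using box[of i] that by auto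
  have along: "\<exists>e>0. \<forall>s\<in>{-e<..<e}. g s \<in> N i \<and> T i (g s) = T i (g 0) + s"
    if "g 0 \<in> N i" "smooth_germ F' g" for i g using box[of i] that by auto
  have "open (\<Inter>i. N i)" "0 \<in> (\<Inter>i. N i)" using opN N0 by auto
  then obtain \<rho>0 where \<rho>0: "\<rho>0 > 0" "ball 0 \<rho>0 \<subseteq> (\<Inter>i. N i)" by (meson open_contains_ball)
  define \<rho> where "\<rho> = min \<rho>0 (min r S)"
  have "\<rho> > 0" using \<rho>0 \<open>r > 0\<close> \<open>S > 0\<close> by (simp add: \<rho>_def)
  have \<rho>: "p \<in> N i" "p \<in> ball 0 r" "p \<in> ball 0 S" if "p \<in> ball 0 \<rho>" for p i
    using that \<rho>0(2) by (auto simp: \<rho>_def)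
  define k where "k p = (\<chi> i. T i p)" for p
  have "continuous_on (ball 0 \<rho>) (T i)" for i
  proof (rule lipschitz_on_continuous_on[of "2 / \<bar>v $ i\<bar>"], rule lipschitz_onI)
    fix p q :: plane assume pq: "p \<in> ball 0 \<rho>" "q \<in> ball 0 \<rho>"
    have "\<bar>A\<bar> \<le> 2 * n" if "\<bar>A - B\<bar> \<le> n / 4" "\<bar>B\<bar> \<le> n" for A B n :: real
      using that by linarith
    from this[OF est[OF \<rho>(1)[OF pq(1)] \<rho>(1)[OF pq(2)]]]
    have "\<bar>v $ i * (T i p - T i q)\<bar> \<le> 2 * norm (p - q)"
      using component_le_norm_cart[of "p - q" i] by simp
    then have "\<bar>v $ i\<bar> * \<bar>T i p - T i q\<bar> \<le> 2 * norm (p - q)" by (simp only: abs_mult)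
    then have "\<bar>T i p - T i q\<bar> \<le> (2 * norm (p - q)) / \<bar>v $ i\<bar>"
      using F0[of i] by (simp add: v_def pos_le_divide_eq mult.commute)
    then show "dist (T i p) (T i q) \<le> 2 / \<bar>v $ i\<bar> * dist p q" by (simp add: dist_norm)
  qed simp
  then have cont: "continuous_on (ball 0 \<rho>) k" unfolding k_def by (intro continuous_on_vec_lambda)
  have inj: "inj_on k (ball 0 \<rho>)"
  proof (rule inj_onI)
    fix p q :: plane assume pq: "p \<in> ball 0 \<rho>" "q \<in> ball 0 \<rho>" and "k p = k q"
    then have "T i p = T i q" for i by (simp add: k_def vec_eq_iff)
    then have "\<bar>(p - q) $ i\<bar> \<le> norm (p - q) / 4" for i
      using est[OF \<rho>(1)[OF pq(1)] \<rho>(1)[OF pq(2)], of i] by (simp add: abs_minus_commute)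
    then have "(\<Sum>i\<in>UNIV. \<bar>(p - q) $ i\<bar>) \<le> (\<Sum>i\<in>(UNIV::2 set). norm (p - q) / 4)"
      by (intro sum_mono)
    also have "\<dots> = norm (p - q) / 2" by simp
    finally have "norm (p - q) \<le> norm (p - q) / 2"
      using norm_le_l1_cart[of "p - q"] by linarith
    then show "p = q" by simp
  qed
  have sgn: "sgn (k p $ i) = sgn (F 0 $ i) * sgn (p $ i)" if p: "p \<in> ball 0 \<rho>" for p i
  proof -
    \<comment> \<open>Compare \<open>p\<close> with its projection to the axis, where the time is \<open>0\<close>.\<close>
    define q where "q = p - axis i (p $ i)"
    have "norm q \<le> norm p"
      by (rule norm_le_componentwise_cart) (simp add: q_def axis_def)
    then have "q \<in> ball 0 \<rho>" using p by simp
    moreover have "q $ i = 0" by (simp add: q_def axis_def)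
    ultimately have "T i q = 0" using ax \<rho>(3) by blast
    with est[OF \<rho>(1)[OF p] \<rho>(1)[OF \<open>q \<in> ball 0 \<rho>\<close>], of i] \<open>q $ i = 0\<close>
    have "\<bar>v $ i * k p $ i - p $ i\<bar> \<le> \<bar>p $ i\<bar> / 4"
      by (simp add: k_def q_def norm_axis)
    moreover have "sgn A = sgn B" if "\<bar>A - B\<bar> \<le> \<bar>B\<bar> / 4" for A B :: real
    proof -
      have "A > 0" if "B > 0" using that \<open>\<bar>A - B\<bar> \<le> \<bar>B\<bar> / 4\<close> by linarith
      moreover have "A < 0" if "B < 0" using that \<open>\<bar>A - B\<bar> \<le> \<bar>B\<bar> / 4\<close> by linarith
      ultimately show ?thesis using that by (cases B "0::real" rule: linorder_cases) auto
    qed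
    ultimately have "sgn (v $ i * k p $ i) = sgn (p $ i)" by blast
    then have "sgn (v $ i) * sgn (v $ i * k p $ i) = sgn (v $ i) * sgn (p $ i)" by simp
    moreover have "sgn (v $ i) * sgn (v $ i) = 1"
      using F0[of i] unfolding v_def by simp
    ultimately show ?thesis
      by (simp only: v_def sgn_mult mult.assoc[symmetric] mult_1_left)
  qed
  have ex: "\<exists>g. g 0 = p \<and> smooth_germ F g" if p: "p \<in> ball 0 \<rho>" for p
  proof -
    obtain g where g: "g 0 = p" "solves F' {-S..S} g"
      using picard_exists[OF lip' \<open>0 \<le> L\<close> \<open>0 < S\<close> LS'] by blast
    have "solves F' {-S<..<S} g" by (rule solves_subset[OF g(2)]) auto
    then have "smooth_germ F' g" using \<open>S > 0\<close> by (auto simp: smooth_germ_def)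
    then have "smooth_germ F g"
      by (rule smooth_germ_agree[OF _ open_ball[of 0 r]]) (use agree \<rho>(2)[OF p] g(1) in simp_all)
    then show ?thesis using g(1) by blast
  qed
  have flow: "\<exists>e>0. \<forall>s\<in>{-e<..<e}. k (g s) = k (g 0) + vec s"
    if g: "g 0 \<in> ball 0 \<rho>" "smooth_germ F g" for g
  proof -
    have g': "smooth_germ F' g"
      by (rule smooth_germ_agree[OF g(2) open_ball \<rho>(2)[OF g(1)] agree])
    have ev: "\<exists>e>0. \<forall>s\<in>{-e<..<e}. T i (g s) = T i (g 0) + s" for i
    proof -
      obtain e where "e > 0" "\<forall>s\<in>{-e<..<e}. g s \<in> N i \<and> T i (g s) = T i (g 0) + s"
        using along[of g i, OF \<rho>(1)[OF g(1)] g'] by (elim exE conjE)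
      then show ?thesis by blast
    qed
    obtain e1 where e1: "e1 > 0" "\<forall>s\<in>{-e1<..<e1}. T 1 (g s) = T 1 (g 0) + s"
      using ev[of 1] by (elim exE conjE)
    obtain e2 where e2: "e2 > 0" "\<forall>s\<in>{-e2<..<e2}. T 2 (g s) = T 2 (g 0) + s"
      using ev[of 2] by (elim exE conjE)
    have "k (g s) = k (g 0) + vec s" if "s \<in> {-min e1 e2<..<min e1 e2}" for s
    proof -
      have "T 1 (g s) = T 1 (g 0) + s" by (rule bspec[OF e1(2) symmetric_interval_min(1)[OF that]])
      moreover have "T 2 (g s) = T 2 (g 0) + s" by (rule bspec[OF e2(2) symmetric_interval_min(2)[OF that]])
      ultimately have "T i (g s) = T i (g 0) + s" for i using exhaust_2[of i] by metis
      then show ?thesis unfolding k_def vec_eq_iff by (simp only: vec_lambda_beta vector_add_component vec_component simp_thms)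
    qed
    moreover have "min e1 e2 > 0" using e1(1) e2(1) by simp
    ultimately show ?thesis by blast
  qed
  have "time_chart F \<rho> k"
    unfolding time_chart_def
  proof (intro conjI ballI allI impI)
    show "\<exists>e>0. \<forall>s\<in>{-e<..<e}. k (g s) = k (g 0) + vec s"
      if "g 0 \<in> ball 0 \<rho> \<and> smooth_germ F g" for g
      by (rule flow) (use that in auto)
  qed (rule cont inj sgn ex; assumption)+
  then show ?thesis using \<open>\<rho> > 0\<close> by (intro exI conjI)
qed


section \<open>Gluing the crossing times of two fields\<close>

text \<open>If \<open>z\<close> holds the two crossing times of a point, this is the signed time since the crossing nearest in
  time when both crossings lie in the past or both in the future, and \<open>0\<close> when one lies in the past and the
  other in the future.\<close>

definition elapsed :: "plane \<Rightarrow> real" where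
  "elapsed z = max (min (z$1) (z$2)) 0 + min (max (z$1) (z$2)) 0"

definition to_axis :: "plane \<Rightarrow> plane" where
  "to_axis z = z - vec (elapsed z)"

lemma elapsed_continuous: "continuous_on A elapsed"
  unfolding elapsed_def by (intro continuous_intros)

lemma to_axis_continuous: "continuous_on A to_axis"
  unfolding to_axis_def vec_def
  by (intro continuous_intros elapsed_continuous continuous_on_vec_lambda)

lemma norm_to_axis: "norm (to_axis z) \<le> norm z"
proof (rule norm_le_componentwise_cart)
  have "\<bar>z$1 - elapsed z\<bar> \<le> \<bar>z$1\<bar>" "\<bar>z$2 - elapsed z\<bar> \<le> \<bar>z$2\<bar>"
    unfolding elapsed_def by (auto simp: max_def min_def)
  then show "norm (to_axis z $ i) \<le> norm (z $ i)" for i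
    using exhaust_2[of i] by (auto simp: to_axis_def)
qed

lemma elapsed_shift:
  assumes "z$1 * z$2 > 0" "\<bar>s\<bar> < \<bar>z$1\<bar>" "\<bar>s\<bar> < \<bar>z$2\<bar>"
  shows "elapsed (z + vec s) = elapsed z + s"
proof -
  from assms(1) consider "z$1 > 0" "z$2 > 0" | "z$1 < 0" "z$2 < 0"
    by (auto simp: zero_less_mult_iff)
  then show ?thesis
  proof cases
    case 1
    then have "elapsed z = min (z$1) (z$2)" "elapsed (z + vec s) = min (z$1 + s) (z$2 + s)"
      using assms(2,3) by (auto simp: elapsed_def)
    then show ?thesis by simp
  next
    case 2
    then have "elapsed z = max (z$1) (z$2)" "elapsed (z + vec s) = max (z$1 + s) (z$2 + s)"
      using assms(2,3) by (auto simp: elapsed_def)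
    then show ?thesis by simp
  qed
qed

lemma elapsed_eq_0: "z$1 * z$2 \<le> 0 \<Longrightarrow> elapsed z = 0"
  by (auto simp: elapsed_def mult_le_0_iff)

text \<open>The point \<open>w\<close> lies in the same closed quadrant as \<open>to_axis z\<close>, so either \<open>elapsed z = 0\<close>, or \<open>w\<close> lies
  on an axis, on the half-line on the same side as \<open>z\<close>.  In both cases shifting \<open>w\<close> by
  \<open>elapsed z\<close> produces a point from which that shift can be read off again.  This is what
  makes the glued chart injective.\<close>

lemma elapsed_recover:
  assumes "\<And>i. sgn (w $ i) = sgn (to_axis z $ i)"
  shows "elapsed (w + vec (elapsed z)) = elapsed z"
    and "sgn ((w + vec (elapsed z)) $ i) = sgn (z $ i)"
proof -
  define m where "m = elapsed z"
  have s: "sgn (w$1) = sgn (z$1 - m)" "sgn (w$2) = sgn (z$2 - m)"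
    using assms[of 1] assms[of 2] by (simp_all add: to_axis_def m_def)
  have m: "m = max (min (z$1) (z$2)) 0 + min (max (z$1) (z$2)) 0" by (simp add: m_def elapsed_def)
  have all: "elapsed (w + vec m) = m \<and> sgn (w$1 + m) = sgn (z$1) \<and> sgn (w$2 + m) = sgn (z$2)"
  proof (cases "z$1 * z$2 > 0")
    case False
    then have "m = 0" using elapsed_eq_0[of z] by (simp add: m_def)
    moreover have "elapsed w = 0"
    proof (rule elapsed_eq_0)
      have "sgn (w$1 * w$2) = sgn (z$1 * z$2)" using s \<open>m = 0\<close> by (simp add: sgn_mult)
      then show "w$1 * w$2 \<le> 0" using False by (metis not_less sgn_greater)
    qed
    ultimately show ?thesis using s by simp
  next
    case True
    then consider "z$1 > 0" "z$2 > 0" | "z$1 < 0" "z$2 < 0" by (auto simp: zero_less_mult_iff)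
    then show ?thesis
    proof cases
      case 1
      then have m': "m = min (z$1) (z$2)" by (auto simp: m)
      then have "w$1 \<ge> 0" "w$2 \<ge> 0" "w$1 = 0 \<or> w$2 = 0"
        using s by (auto simp: sgn_real_def min_def split: if_splits)
      then show ?thesis using 1 m' by (auto simp: elapsed_def min_def)
    next
      case 2
      then have m': "m = max (z$1) (z$2)" by (auto simp: m)
      then have "w$1 \<le> 0" "w$2 \<le> 0" "w$1 = 0 \<or> w$2 = 0"
        using s by (auto simp: sgn_real_def max_def split: if_splits)
      then show ?thesis using 2 m' by (auto simp: elapsed_def max_def)
    qed
  qed
  then show "elapsed (w + vec (elapsed z)) = elapsed z" by (simp add: m_def)
  show "sgn ((w + vec (elapsed z)) $ i) = sgn (z $ i)"
    using all exhaust_2[of i] by (auto simp: m_def)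
qed

text \<open>Suppose that \<open>F\<close> governs the quadrants where the two crossing times have equal sign and \<open>G\<close> those
  where the signs differ.  The trajectory through a point of the first kind follows \<open>F\<close> until it meets
  the axis that is nearest in time, at the point with \<open>F\<close>-times \<open>to_axis (kF p)\<close>, and \<open>G\<close> beyond.  So
  its crossing times are those of \<open>G\<close> at that point, shifted by the time spent under \<open>F\<close>.  Where \<open>G\<close>
  governs, that time is \<open>0\<close> and the same formula returns \<open>kG p\<close>; hence \<open>H\<close> is one
  composition of continuous maps, with no pasting along the axes.\<close>

lemma glue_time_charts:
  assumes F: "time_chart F \<rho> kF" and G: "time_chart G \<rho> kG" and "\<rho> > 0"
    and F0: "\<And>i. F 0 $ i \<noteq> 0" and FG: "\<And>i. sgn (G 0 $ i) = sgn (F 0 $ i)"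
  shows "\<exists>\<delta>>0. \<exists>H. continuous_on (ball 0 \<delta>) H \<and> inj_on H (ball 0 \<delta>) \<and>
    (\<forall>p\<in>ball 0 \<delta>. \<forall>i. sgn (H p $ i) = sgn (F 0 $ i) * sgn (p $ i)) \<and>
    (\<forall>g. g 0 \<in> ball 0 \<delta> \<and> smooth_germ F g \<and> (F 0 $ 1 * F 0 $ 2) * (g 0 $ 1 * g 0 $ 2) > 0 \<longrightarrow>
       (\<exists>e>0. \<forall>s\<in>{-e<..<e}. H (g s) = H (g 0) + vec s)) \<and>
    (\<forall>g. g 0 \<in> ball 0 \<delta> \<and> smooth_germ G g \<and> (F 0 $ 1 * F 0 $ 2) * (g 0 $ 1 * g 0 $ 2) < 0 \<longrightarrow>
       (\<exists>e>0. \<forall>s\<in>{-e<..<e}. H (g s) = H (g 0) + vec s))"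
proof -
  have contF: "continuous_on (ball 0 \<rho>) kF" and injF: "inj_on kF (ball 0 \<rho>)"
    and sgnF: "\<And>p i. p \<in> ball 0 \<rho> \<Longrightarrow> sgn (kF p $ i) = sgn (F 0 $ i) * sgn (p $ i)"
    and flowF: "\<And>g. g 0 \<in> ball 0 \<rho> \<Longrightarrow> smooth_germ F g \<Longrightarrow>
       \<exists>e>0. \<forall>s\<in>{-e<..<e}. kF (g s) = kF (g 0) + vec s"
    using F by (simp_all add: time_chart_def)
  have contG: "continuous_on (ball 0 \<rho>) kG" and injG: "inj_on kG (ball 0 \<rho>)"
    and sgnG: "\<And>p i. p \<in> ball 0 \<rho> \<Longrightarrow> sgn (kG p $ i) = sgn (F 0 $ i) * sgn (p $ i)"
    and flowG: "\<And>g. g 0 \<in> ball 0 \<rho> \<Longrightarrow> smooth_germ G g \<Longrightarrow>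
       \<exists>e>0. \<forall>s\<in>{-e<..<e}. kG (g s) = kG (g 0) + vec s"
    using G FG by (simp_all add: time_chart_def)
  define W where "W = kF ` ball 0 \<rho>"
  obtain iF where hom: "homeomorphism (ball 0 \<rho>) W kF iF"
    unfolding W_def by (rule invariance_of_domain_homeomorphism[OF open_ball contF _ injF]) auto
  have iF: "z \<in> W \<Longrightarrow> iF z \<in> ball 0 \<rho>" "z \<in> W \<Longrightarrow> kF (iF z) = z" "p \<in> ball 0 \<rho> \<Longrightarrow> iF (kF p) = p" for z p
    using hom unfolding homeomorphism_def by blast+
  have contiF: "continuous_on W iF" using hom by (simp add: homeomorphism_def)
  have "open W" unfolding W_def by (rule invariance_of_domain[OF contF open_ball injF])
  have "kF 0 = 0"
    using sgnF[of 0] \<open>\<rho> > 0\<close> by (simp add: vec_eq_iff sgn_zero_iff)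
  then have "0 \<in> W" unfolding W_def using \<open>\<rho> > 0\<close> by force
  then obtain \<sigma> where \<sigma>: "\<sigma> > 0" "ball 0 \<sigma> \<subseteq> W" using \<open>open W\<close> open_contains_ball by blast
  have "open (ball 0 \<rho> \<inter> kF -` ball 0 \<sigma>)"
    by (rule continuous_open_preimage[OF contF]) auto
  moreover have "0 \<in> ball 0 \<rho> \<inter> kF -` ball 0 \<sigma>" using \<open>kF 0 = 0\<close> \<sigma> \<open>\<rho> > 0\<close> by simp
  ultimately obtain \<delta> where \<delta>: "\<delta> > 0" "ball 0 \<delta> \<subseteq> ball 0 \<rho> \<inter> kF -` ball 0 \<sigma>"
    using open_contains_ball by blast
  have in_\<rho>: "p \<in> ball 0 \<rho>" and in_\<sigma>: "kF p \<in> ball 0 \<sigma>" if "p \<in> ball 0 \<delta>" for p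
    using that \<delta>(2) by auto
  \<comment> \<open>The transition between the charts preserves the signs of both coordinates.\<close>
  define \<Theta> where "\<Theta> z = kG (iF z)" for z
  define H where "H p = \<Theta> (to_axis (kF p)) + vec (elapsed (kF p))" for p
  have to_axis_W: "to_axis (kF p) \<in> W" if "p \<in> ball 0 \<delta>" for p
    using norm_to_axis[of "kF p"] in_\<sigma>[OF that] \<sigma>(2) by auto
  have \<Theta>sgn: "sgn (\<Theta> z $ i) = sgn (z $ i)" if "z \<in> W" for z i
    using sgnG[OF iF(1)[OF that], of i] sgnF[OF iF(1)[OF that], of i] iF(2)[OF that] by (simp add: \<Theta>_def)
  have recover: "elapsed (H p) = elapsed (kF p)" "sgn (H p $ i) = sgn (kF p $ i)" if "p \<in> ball 0 \<delta>" for p i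
    using elapsed_recover[of "\<Theta> (to_axis (kF p))" "kF p"] \<Theta>sgn[OF to_axis_W[OF that]] by (simp_all add: H_def)
  have contkF: "continuous_on (ball 0 \<delta>) kF"
    by (rule continuous_on_subset[OF contF]) (use \<delta> in auto)
  have cont: "continuous_on (ball 0 \<delta>) H"
  proof -
    have "continuous_on W \<Theta>" unfolding \<Theta>_def
      by (rule continuous_on_compose2[OF contG contiF]) (use iF in auto)
    moreover have "continuous_on (ball 0 \<delta>) (\<lambda>p. to_axis (kF p))"
      by (rule continuous_on_compose2[OF to_axis_continuous contkF]) auto
    ultimately have "continuous_on (ball 0 \<delta>) (\<lambda>p. \<Theta> (to_axis (kF p)))"
      by (rule continuous_on_compose2) (use to_axis_W in auto)
    moreover have "continuous_on (ball 0 \<delta>) (\<lambda>p. elapsed (kF p))"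
      by (rule continuous_on_compose2[OF elapsed_continuous contkF]) auto
    ultimately show ?thesis unfolding H_def vec_def
      by (intro continuous_on_add continuous_on_vec_lambda)
  qed
  have inj: "inj_on H (ball 0 \<delta>)"
  proof (rule inj_onI)
    fix p q :: plane assume pq: "p \<in> ball 0 \<delta>" "q \<in> ball 0 \<delta>" and eq: "H p = H q"
    have e: "elapsed (kF p) = elapsed (kF q)" using recover(1) pq eq by metis
    then have "\<Theta> (to_axis (kF p)) = \<Theta> (to_axis (kF q))" using eq by (simp add: H_def)
    then have "iF (to_axis (kF p)) = iF (to_axis (kF q))"
      unfolding \<Theta>_def using inj_onD[OF injG] iF(1)[OF to_axis_W] pq by blast
    then have "to_axis (kF p) = to_axis (kF q)" using iF(2)[OF to_axis_W] pq by metis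
    then have "kF p = kF q" using e by (simp add: to_axis_def)
    then show "p = q" using inj_onD[OF injF] in_\<rho> pq by blast
  qed
  have sgnH: "sgn (H p $ i) = sgn (F 0 $ i) * sgn (p $ i)" if "p \<in> ball 0 \<delta>" for p i
    using recover(2)[OF that] sgnF[OF in_\<rho>[OF that]] by simp
  have sgn_prod: "sgn (kF p $ 1 * kF p $ 2) = sgn ((F 0 $ 1 * F 0 $ 2) * (p $ 1 * p $ 2))"
    if "p \<in> ball 0 \<delta>" for p
    using sgnF[OF in_\<rho>[OF that]] by (simp add: sgn_mult mult_ac)
  have flow1: "\<exists>e>0. \<forall>s\<in>{-e<..<e}. H (g s) = H (g 0) + vec s"
    if g: "g 0 \<in> ball 0 \<delta>" "smooth_germ F g" and pos: "(F 0 $ 1 * F 0 $ 2) * (g 0 $ 1 * g 0 $ 2) > 0" for g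
  proof -
    obtain e where e: "e > 0" "\<forall>s\<in>{-e<..<e}. kF (g s) = kF (g 0) + vec s"
      using flowF[OF in_\<rho>[OF g(1)] g(2)] by blast
    have pos': "kF (g 0) $ 1 * kF (g 0) $ 2 > 0" using sgn_prod[OF g(1)] pos by (metis sgn_greater)
    define d where "d = min e (min \<bar>kF (g 0) $ 1\<bar> \<bar>kF (g 0) $ 2\<bar>)"
    have "d > 0" using e(1) pos' by (auto simp: d_def)
    moreover have "H (g s) = H (g 0) + vec s" if "s \<in> {-d<..<d}" for s
    proof -
      have "\<bar>s\<bar> < d" using that by auto
      then have s: "\<bar>s\<bar> < \<bar>kF (g 0) $ 1\<bar>" "\<bar>s\<bar> < \<bar>kF (g 0) $ 2\<bar>" "s \<in> {-e<..<e}" by (auto simp: d_def)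
      have k: "kF (g s) = kF (g 0) + vec s" using e(2) s(3) by blast
      have el: "elapsed (kF (g s)) = elapsed (kF (g 0)) + s"
        unfolding k by (rule elapsed_shift[OF pos' s(1,2)])
      then have "to_axis (kF (g s)) = to_axis (kF (g 0))"
        unfolding to_axis_def using k by (simp add: vec_add)
      then show ?thesis by (simp add: H_def el vec_add)
    qed
    ultimately show ?thesis by blast
  qed
  have HG: "H p = kG p" if "p \<in> ball 0 \<delta>" "(F 0 $ 1 * F 0 $ 2) * (p $ 1 * p $ 2) < 0" for p
  proof -
    have "kF p $ 1 * kF p $ 2 < 0" using sgn_prod[OF that(1)] that(2) by (metis sgn_less)
    then have "elapsed (kF p) = 0" by (intro elapsed_eq_0) simp
    then show ?thesis using iF(3)[OF in_\<rho>[OF that(1)]] by (simp add: H_def to_axis_def \<Theta>_def)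
  qed
  have flow2: "\<exists>e>0. \<forall>s\<in>{-e<..<e}. H (g s) = H (g 0) + vec s"
    if g: "g 0 \<in> ball 0 \<delta>" "smooth_germ G g" and neg: "(F 0 $ 1 * F 0 $ 2) * (g 0 $ 1 * g 0 $ 2) < 0" for g
  proof -
    obtain e where e: "e > 0" "\<forall>s\<in>{-e<..<e}. kG (g s) = kG (g 0) + vec s"
      using flowG[OF in_\<rho>[OF g(1)] g(2)] by blast
    define N where "N = ball 0 \<delta> \<inter> {p::plane. (F 0 $ 1 * F 0 $ 2) * (p $ 1 * p $ 2) < 0}"
    have "open N" unfolding N_def by (intro open_Int open_ball open_Collect_less continuous_intros)
    then obtain d where d: "d > 0" "\<forall>s\<in>{-d<..<d}. g s \<in> N"
      using smooth_germ_continuous_near[OF g(2), of N] g(1) neg by (auto simp: N_def)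
    show ?thesis
    proof (intro exI[of _ "min d e"] conjI ballI)
      show "min d e > 0" using d e by simp
      fix s assume "s \<in> {-min d e<..<min d e}"
      note s = symmetric_interval_min[OF this]
      have "g s \<in> N" using d(2) s(1) by blast
      then have "H (g s) = kG (g s)" by (intro HG) (simp_all add: N_def)
      moreover have "kG (g s) = kG (g 0) + vec s" using e(2) s(2) by blast
      ultimately show "H (g s) = H (g 0) + vec s" using HG[OF g(1) neg] by metis
    qed
  qed
  show ?thesis
  proof (rule exI[of _ \<delta>], rule conjI[OF \<delta>(1)], rule exI[of _ H], intro conjI allI impI)
    show "\<exists>e>0. \<forall>s\<in>{-e<..<e}. H (g s) = H (g 0) + vec s"
      if "g 0 \<in> ball 0 \<delta> \<and> smooth_germ F g \<and> (F 0 $ 1 * F 0 $ 2) * (g 0 $ 1 * g 0 $ 2) > 0" for g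
      using that by (elim conjE) (rule flow1)
    show "\<exists>e>0. \<forall>s\<in>{-e<..<e}. H (g s) = H (g 0) + vec s"
      if "g 0 \<in> ball 0 \<delta> \<and> smooth_germ G g \<and> (F 0 $ 1 * F 0 $ 2) * (g 0 $ 1 * g 0 $ 2) < 0" for g
      using that by (elim conjE) (rule flow2)
  qed (use cont inj sgnH in auto)
qed


section \<open>Trajectories near a crossing point\<close>

lemma smooth_germ_shift:
  assumes "solves F K g" "open J" "s \<in> J" "J \<subseteq> K"
  shows "smooth_germ F (\<lambda>r. g (s + r))"
proof -
  obtain d where d: "d > 0" "ball s d \<subseteq> J" using assms(2,3) open_contains_ball by blast
  have "solves F {-d<..<d} (\<lambda>r. g (s + r))"
  proof (rule solves_shift[OF assms(1)])
    fix r assume "r \<in> {-d<..<d}"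
    then have "s + r \<in> ball s d" by (auto simp: dist_norm)
    then show "s + r \<in> K" using d(2) assms(4) by blast
  qed
  then show ?thesis using d(1) unfolding smooth_germ_def by blast
qed

lemma concat_germ_cong:
  assumes "concat_germ F A G B g" "d > 0" and eq: "\<And>s. s \<in> {-d<..<d} \<Longrightarrow> f s = g s"
  shows "concat_germ F A G B f"
proof -
  obtain e where e: "e > 0" "g ` {-e<..<0} \<subseteq> A" "solves F {-e<..0} g" "g ` {0<..<e} \<subseteq> B" "solves G {0..<e} g"
    using assms(1) unfolding concat_germ_def by blast
  define m where "m = min d e"
  have m: "m > 0" "m \<le> d" "m \<le> e" using e(1) assms(2) by (simp_all add: m_def)
  have eq': "f s = g s" if "s \<in> {-m<..<m}" for s
    by (rule eq) (use that m in simp)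
  have "f ` {-m<..<0} \<subseteq> A"
  proof (rule image_subsetI)
    fix s assume "s \<in> {-m<..<0}"
    then have "f s = g s" "s \<in> {-e<..<0}" using eq'[of s] m by simp_all
    then show "f s \<in> A" using e(2) by auto
  qed
  moreover have "f ` {0<..<m} \<subseteq> B"
  proof (rule image_subsetI)
    fix s assume "s \<in> {0<..<m}"
    then have "f s = g s" "s \<in> {0<..<e}" using eq'[of s] m by simp_all
    then show "f s \<in> B" using e(4) by auto
  qed
  moreover have "solves F {-m<..0} f"
  proof (rule solves_cong)
    show "solves F {-m<..0} g" by (rule solves_subset[OF e(3)]) (use m in auto)
    show "f s = g s" if "s \<in> {-m<..0}" for s by (rule eq') (use that m in simp)
  qed
  moreover have "solves G {0..<m} f"
  proof (rule solves_cong)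
    show "solves G {0..<m} g" by (rule solves_subset[OF e(5)]) (use m in auto)
    show "f s = g s" if "s \<in> {0..<m}" for s by (rule eq') (use that m in simp)
  qed
  ultimately show ?thesis unfolding concat_germ_def using m(1) by blast
qed

lemma interior_germ_cong:
  assumes "interior_germ U (X, Y) g" "d > 0" and eq: "\<And>s. s \<in> {-d<..<d} \<Longrightarrow> f s = g s"
  shows "interior_germ U (X, Y) f"
proof -
  have step: "\<exists>e>0. f ` {-e<..<e} \<subseteq> A \<and> solves F {-e<..<e} f"
    if "\<exists>e>0. g ` {-e<..<e} \<subseteq> A \<and> solves F {-e<..<e} g" for A F
  proof -
    from that obtain e where e: "e > 0" "g ` {-e<..<e} \<subseteq> A" "solves F {-e<..<e} g"
      by (elim exE conjE)
    define m where "m = min d e"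
    have m: "m > 0" "m \<le> d" "m \<le> e" using e(1) assms(2) by (simp_all add: m_def)
    have eq': "f s = g s" if "s \<in> {-m<..<m}" for s
      by (rule eq) (use that m in simp)
    have "f ` {-m<..<m} \<subseteq> A"
    proof (rule image_subsetI)
      fix s assume "s \<in> {-m<..<m}"
      then have "f s = g s" "s \<in> {-e<..<e}" using eq'[of s] m by simp_all
      then show "f s \<in> A" using e(2) by auto
    qed
    moreover have "solves F {-m<..<m} f"
    proof (rule solves_cong)
      show "solves F {-m<..<m} g" by (rule solves_subset[OF e(3)]) (use m in auto)
      show "f s = g s" if "s \<in> {-m<..<m}" for s by (rule eq'[OF that])
    qed
    ultimately show ?thesis using m(1) by (intro exI[of _ m] conjI)
  qed
  show ?thesis
    using assms(1) unfolding interior_germ_def prod.case by (rule disj_forward) (rule step, assumption)+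
qed

text \<open>A nonzero coordinate keeps its sign for a short time; a vanishing one takes the sign of the time
  multiplied by that of its velocity.\<close>

lemma component_sign_near:
  fixes g :: "real \<Rightarrow> real^'n"
  assumes d: "(g has_vector_derivative w) (at 0)" and w: "w $ i \<noteq> 0"
  shows "\<forall>\<^sub>F s in at 0. sgn (g s $ i) = (if g 0 $ i \<noteq> 0 then sgn (g 0 $ i) else sgn s * sgn (w $ i))"
proof -
  have f: "((\<lambda>s. g s $ i) has_real_derivative w $ i) (at 0)"
    unfolding has_real_derivative_iff_has_vector_derivative
    by (rule bounded_linear.has_vector_derivative[OF bounded_linear_vec_nth d])
  show ?thesis
  proof (cases "g 0 $ i = 0")
    case False
    have "((\<lambda>s. g s $ i * g 0 $ i) \<longlongrightarrow> g 0 $ i * g 0 $ i) (at 0)"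
      using DERIV_isCont[OF f] by (intro tendsto_mult tendsto_const) (simp add: isCont_def)
    moreover have "g 0 $ i * g 0 $ i > 0" using False by (metis not_real_square_gt_zero)
    ultimately have "\<forall>\<^sub>F s in at 0. 0 < g s $ i * g 0 $ i" by (rule order_tendstoD(1))
    then show ?thesis
    proof eventually_elim
      case (elim s)
      then show ?case using False by (auto simp: sgn_real_def zero_less_mult_iff)
    qed
  next
    case True
    have "((\<lambda>s. g s $ i / s) \<longlongrightarrow> w $ i) (at 0)"
      using f True by (simp add: has_field_derivative_iff)
    then have "((\<lambda>s. g s $ i / s * w $ i) \<longlongrightarrow> w $ i * w $ i) (at 0)" by (intro tendsto_intros)
    moreover have "w $ i * w $ i > 0" using w by (metis not_real_square_gt_zero)
    ultimately have "\<forall>\<^sub>F s in at 0. 0 < g s $ i / s * w $ i" by (rule order_tendstoD(1))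
    then show ?thesis
    proof eventually_elim
      case (elim s)
      then have "0 < g s $ i / s \<and> 0 < w $ i \<or> g s $ i / s < 0 \<and> w $ i < 0"
        by (simp only: zero_less_mult_iff)
      then show ?case using True by (auto simp: zero_less_divide_iff divide_less_0_iff)
    qed
  qed
qed

text \<open>Each field is straightened only in the region where it governs the motion.  Since \<open>h\<close> is a single
  continuous map, this already determines what happens to trajectories that cross the axes.\<close>

locale crossing_chart =
  fixes U V :: "plane set" and X Y :: field2 and v :: plane and h :: "plane \<Rightarrow> plane"
  assumes open_V: "open V" and V_sub: "V \<subseteq> U"
    and cont_h: "continuous_on V h" and inj_h: "inj_on h V"
    and v_nz: "v $ i \<noteq> 0"
    and dir_X: "p \<in> V \<Longrightarrow> sgn (X p $ i) = sgn (v $ i)"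
    and dir_Y: "p \<in> V \<Longrightarrow> sgn (Y p $ i) = sgn (v $ i)"
    and sol_X: "p \<in> V \<Longrightarrow> \<exists>g. g 0 = p \<and> smooth_germ X g"
    and sol_Y: "p \<in> V \<Longrightarrow> \<exists>g. g 0 = p \<and> smooth_germ Y g"
    and flow_X: "\<lbrakk>g 0 \<in> V; g 0 \<in> Upos U; smooth_germ X g\<rbrakk> \<Longrightarrow>
      \<exists>e>0. \<forall>s\<in>{-e<..<e}. h (g s) = h (g 0) + s *\<^sub>R v"
    and flow_Y: "\<lbrakk>g 0 \<in> V; g 0 \<in> Uneg U; smooth_germ Y g\<rbrakk> \<Longrightarrow>
      \<exists>e>0. \<forall>s\<in>{-e<..<e}. h (g s) = h (g 0) + s *\<^sub>R v"
begin

definition straight :: "germ \<Rightarrow> bool" where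
  "straight g \<longleftrightarrow> (\<exists>e>0. \<forall>s\<in>{-e<..<e}. g s \<in> V \<and> h (g s) = h (g 0) + s *\<^sub>R v)"

definition governs :: "field2 \<Rightarrow> plane set \<Rightarrow> bool" where
  "governs F A \<longleftrightarrow> F = X \<and> A = Upos U \<or> F = Y \<and> A = Uneg U"

lemma governs_flow:
  assumes "governs F A" "g 0 \<in> V" "g 0 \<in> A" "smooth_germ F g"
  shows "\<exists>e>0. \<forall>s\<in>{-e<..<e}. h (g s) = h (g 0) + s *\<^sub>R v"
  using assms(1) unfolding governs_def
proof (elim disjE conjE)
  assume "F = X" "A = Upos U"
  then show ?thesis using assms by (intro flow_X) simp_all
next
  assume "F = Y" "A = Uneg U"
  then show ?thesis using assms by (intro flow_Y) simp_all
qed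

text \<open>Away from time \<open>0\<close> the curve lies in a region that one field governs, so \<open>h (g s) - s v\<close> has derivative
  zero there; being continuous at \<open>0\<close> as well, it is constant.  On the axes
  only the continuity of \<open>h\<close> enters.\<close>

lemma concat_germ_straight:
  assumes FA: "governs F A" and GB: "governs G B" and g: "concat_germ F A G B g" and g0: "g 0 \<in> V"
  shows "straight g"
proof -
  obtain e where e: "e > 0" "g ` {-e<..<0} \<subseteq> A" "solves F {-e<..0} g" "g ` {0<..<e} \<subseteq> B" "solves G {0..<e} g"
    using g by (auto simp: concat_germ_def)
  have split: "{-e<..<e} = {-e<..0} \<union> {0..<e}" using e(1) by auto
  have cont: "continuous_on {-e<..<e} g"
    unfolding split
  proof (rule continuous_on_Un_local)
    have "{-e<..0} = ({-e<..0} \<union> {0..<e}) \<inter> {..0}" "{0..<e} = ({-e<..0} \<union> {0..<e}) \<inter> {0..}"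
      using e(1) by auto
    then show "closedin (top_of_set ({-e<..0} \<union> {0..<e})) {-e<..0}"
      "closedin (top_of_set ({-e<..0} \<union> {0..<e})) {0..<e}"
      by (metis closedin_closed_Int closed_atMost, metis closedin_closed_Int closed_atLeast)
  qed (use e solves_continuous_on in auto)
  have "isCont g 0" using cont e(1) by (auto simp: continuous_on_eq_continuous_at)
  then have "\<forall>\<^sub>F s in at 0. g s \<in> V" using open_V g0 by (auto simp: isCont_def intro: topological_tendstoD)
  then obtain d where d: "d > 0" "\<And>s. s \<noteq> 0 \<Longrightarrow> dist s 0 < d \<Longrightarrow> g s \<in> V" by (auto simp: eventually_at)
  define m where "m = min d e"
  have "m > 0" using d e by (simp add: m_def)
  have inV: "g s \<in> V" if "s \<in> {-m<..<m}" for s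
  proof (cases "s = 0")
    case False
    have "\<bar>s\<bar> < m" using that by auto
    then show ?thesis using d(2)[OF False] by (simp add: m_def)
  qed (use g0 in simp)
  have ine: "s \<in> {-e<..<e}" if "s \<in> {-m<..<m}" for s
    using symmetric_interval_min(2) that unfolding m_def by blast
  define c where "c s = h (g s) - s *\<^sub>R v" for s
  have "continuous_on {-m<..<m} (\<lambda>s. h (g s))"
    by (rule continuous_on_compose2[OF cont_h continuous_on_subset[OF cont]]) (use inV ine in auto)
  then have c_cont: "continuous_on {-m<..<m} c" unfolding c_def by (intro continuous_intros)
  have c_der: "(c has_derivative (\<lambda>_. 0)) (at s within {-m<..<m})" if s: "s \<in> {-m<..<m} - {0}" for s
  proof -
    have "\<exists>e>0. \<forall>r\<in>{-e<..<e}. h (g (s + r)) = h (g (s + 0)) + r *\<^sub>R v"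
    proof (cases "s > 0")
      case True
      then have "s \<in> {0<..<e}" using ine[of s] s by auto
      then have "smooth_germ G (\<lambda>r. g (s + r))"
        by (intro smooth_germ_shift[OF e(5), of "{0<..<e}"]) auto
      moreover have "g (s + 0) \<in> B" using \<open>s \<in> {0<..<e}\<close> e(4) by auto
      ultimately show ?thesis using inV[of s] s by (intro governs_flow[OF GB]) auto
    next
      case False
      then have "s \<in> {-e<..<0}" using ine[of s] s by auto
      then have "smooth_germ F (\<lambda>r. g (s + r))"
        by (intro smooth_germ_shift[OF e(3), of "{-e<..<0}"]) auto
      moreover have "g (s + 0) \<in> A" using \<open>s \<in> {-e<..<0}\<close> e(2) by auto
      ultimately show ?thesis using inV[of s] s by (intro governs_flow[OF FA]) auto
    qed
    then obtain \<epsilon> where \<epsilon>: "\<epsilon> > 0" "\<And>r. r \<in> {-\<epsilon><..<\<epsilon>} \<Longrightarrow> h (g (s + r)) = h (g (s + 0)) + r *\<^sub>R v"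
      by blast
    have "((\<lambda>_. c s) has_derivative (\<lambda>_. 0)) (at s within {-m<..<m})" by simp
    then show ?thesis
    proof (rule has_derivative_transform_within[OF _ \<epsilon>(1)])
      fix t assume "dist t s < \<epsilon>"
      then have "t - s \<in> {-\<epsilon><..<\<epsilon>}" by (auto simp: dist_real_def)
      from \<epsilon>(2)[OF this] show "c s = c t" by (simp add: c_def algebra_simps)
    qed (use s in simp)
  qed
  have "c s = c 0" if "s \<in> {-m<..<m}" for s
    using has_derivative_zero_unique_strong_connected[OF _ _ _ c_cont _ refl c_der that, of 0] \<open>m > 0\<close> by simp
  then have "h (g s) = h (g 0) + s *\<^sub>R v" if "s \<in> {-m<..<m}" for s
    using that unfolding c_def by (metis diff_add_cancel diff_zero scaleR_zero_left)
  then show ?thesis using \<open>m > 0\<close> inV unfolding straight_def by blast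
qed

lemma not_sliding:
  assumes "p \<in> V"
  shows "p \<notin> Sliding U (X, Y) i \<and> p \<notin> Escaping U (X, Y) i"
proof -
  have eq: "sgn (X p $ i) = sgn (Y p $ i)" using dir_X[OF assms] dir_Y[OF assms] by simp
  have "\<not> (X p $ i < 0 \<and> Y p $ i > 0)" "\<not> (X p $ i > 0 \<and> Y p $ i < 0)"
    using eq by auto
  then show ?thesis unfolding Sliding_def Escaping_def by simp
qed

lemma crossing_all: "p \<in> V \<Longrightarrow> p \<in> Axis U i \<Longrightarrow> p \<in> Crossing U (X, Y) i"
proof -
  assume p: "p \<in> V" "p \<in> Axis U i"
  have "sgn (X p $ i * Y p $ i) = sgn (v $ i) * sgn (v $ i)" using p dir_X dir_Y by (simp add: sgn_mult)
  also have "\<dots> = 1" using v_nz[of i] by simp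
  finally show ?thesis using p(2) by (simp add: Crossing_def sgn_1_pos)
qed

text \<open>Inside \<open>V\<close> the crossing region is the whole axis and the other two regions are empty, so none of them
  has a boundary point there.\<close>

lemma no_boundary:
  assumes "p \<in> V"
  shows "p \<notin> top_of_set (Axis U i) frontier_of Escaping U (X, Y) i"
    and "p \<notin> top_of_set (Axis U i) frontier_of Sliding U (X, Y) i"
    and "p \<notin> top_of_set (Axis U i) frontier_of Crossing U (X, Y) i"
proof -
  have op: "openin (top_of_set (Axis U i)) (Axis U i \<inter> V)" by (rule openin_open_Int[OF open_V])
  have far: "p \<notin> top_of_set (Axis U i) closure_of S" if "V \<inter> S = {}" for S
  proof
    assume "p \<in> top_of_set (Axis U i) closure_of S"
    then show False using op assms that by (auto simp: in_closure_of)
  qed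
  have "V \<inter> Escaping U (X, Y) i = {}" "V \<inter> Sliding U (X, Y) i = {}" using not_sliding by auto
  then show "p \<notin> top_of_set (Axis U i) frontier_of Escaping U (X, Y) i"
    "p \<notin> top_of_set (Axis U i) frontier_of Sliding U (X, Y) i"
    using far by (simp_all add: frontier_of_def)
  show "p \<notin> top_of_set (Axis U i) frontier_of Crossing U (X, Y) i"
  proof
    assume p: "p \<in> top_of_set (Axis U i) frontier_of Crossing U (X, Y) i"
    have "p \<in> Axis U i" using p by (auto simp: frontier_of_def in_closure_of)
    moreover have "Axis U i \<inter> V \<subseteq> top_of_set (Axis U i) interior_of Crossing U (X, Y) i"
      by (rule interior_of_maximal[OF _ op]) (use crossing_all in auto)
    ultimately show False using p assms by (auto simp: frontier_of_def)
  qed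
qed

lemma Sig_crossing:
  assumes "0 \<in> V"
  shows "\<exists>d>0. Sig U \<inter> ball 0 d \<subseteq> closure (\<Union>i. Crossing U (X, Y) i)"
proof -
  obtain d where d: "d > 0" "ball 0 d \<subseteq> V" using assms open_V open_contains_ball by blast
  have "Sig U \<inter> ball 0 d \<subseteq> (\<Union>i. Crossing U (X, Y) i)"
  proof
    fix p assume p: "p \<in> Sig U \<inter> ball 0 d"
    then have "p \<in> V" using d by blast
    have "p \<in> Axis U 1 \<or> p \<in> Axis U 2" using p by (auto simp: Sig_def Axis_def)
    then show "p \<in> (\<Union>i. Crossing U (X, Y) i)" using crossing_all[OF \<open>p \<in> V\<close>] by blast
  qed
  then show ?thesis using d(1) closure_subset by blast
qed

definition regular_germ :: "germ \<Rightarrow> bool" where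
  "regular_germ g \<longleftrightarrow> interior_germ U (X, Y) g \<or> crossing_germ U (X, Y) g \<or>
     g 0 = 0 \<and> (concat_germ X (Upos U) X (Upos U) g \<or> concat_germ Y (Uneg U) Y (Uneg U) g)"

text \<open>With all axis points of \<open>V\<close> crossing, the rules for sliding and boundary points never apply, and the
  origin falls under the first of its three cases.\<close>

lemma trajectory_germ_iff_regular:
  assumes "g 0 \<in> V"
  shows "trajectory_germ U (X, Y) g \<longleftrightarrow> regular_germ g"
proof -
  have "\<not> sliding_germ U (X, Y) g"
    using not_sliding[OF assms] by (force simp: sliding_germ_def slide_germ_def)
  moreover have "\<not> boundary_germ U (X, Y) g"
    using no_boundary[OF assms] unfolding boundary_germ_def Let_def by simp
  moreover have "origin_germ U (X, Y) g \<longleftrightarrow>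
    g 0 = 0 \<and> (concat_germ X (Upos U) X (Upos U) g \<or> concat_germ Y (Uneg U) Y (Uneg U) g)"
  proof (cases "g 0 = 0")
    case True
    then have "\<exists>d>0. Sig U \<inter> ball 0 d \<subseteq> closure (\<Union>i. Crossing U (X, Y) i)"
      using Sig_crossing assms by simp
    then show ?thesis unfolding origin_germ_def prod.case by (simp only: if_True)
  qed (simp add: origin_germ_def)
  ultimately show ?thesis unfolding trajectory_germ_def regular_germ_def by simp
qed

lemma regular_germ_straight:
  assumes "regular_germ g" "g 0 \<in> V"
  shows "straight g"
proof -
  have X: "governs X (Upos U)" and Y: "governs Y (Uneg U)" by (auto simp: governs_def)
  have concat: "straight g" if "concat_germ F A G B g" "governs F A" "governs G B" for F A G B
    by (rule concat_germ_straight[OF that(2,3,1) assms(2)])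
  have interior: "straight g"
    if "\<exists>e>0. g ` {-e<..<e} \<subseteq> A \<and> solves F {-e<..<e} g" "governs F A" for F A
  proof -
    from that(1) obtain e where e: "e > 0" "g ` {-e<..<e} \<subseteq> A" "solves F {-e<..<e} g"
      by (elim exE conjE)
    have "concat_germ F A F A g" unfolding concat_germ_def
      by (intro exI[of _ e] conjI solves_subset[OF e(3)] order_trans[OF image_mono e(2)] e(1)) auto
    then show ?thesis by (rule concat[OF _ that(2) that(2)])
  qed
  from assms(1) consider "interior_germ U (X, Y) g" | "crossing_germ U (X, Y) g"
    | "concat_germ X (Upos U) X (Upos U) g" | "concat_germ Y (Uneg U) Y (Uneg U) g"
    unfolding regular_germ_def by (elim disjE conjE)
  then show ?thesis
  proof cases
    case 1
    then show ?thesis unfolding interior_germ_def prod.case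
      by (elim disjE) (rule interior[OF _ X], assumption, rule interior[OF _ Y], assumption)
  next
    case 2
    then show ?thesis unfolding crossing_germ_def prod.case
      by (elim disjE conjE) (rule concat[OF _ X Y], assumption, rule concat[OF _ Y X], assumption)
  next
    case 3
    then show ?thesis by (rule concat[OF _ X X])
  next
    case 4
    then show ?thesis by (rule concat[OF _ Y Y])
  qed
qed

lemma regular_germ_cong:
  assumes "regular_germ g" "d > 0" and eq: "\<And>s. s \<in> {-d<..<d} \<Longrightarrow> f s = g s"
  shows "regular_germ f"
proof -
  have f0: "f 0 = g 0" using assms(2) by (intro eq) simp
  note concat = concat_germ_cong[OF _ assms(2) eq]
  note interior = interior_germ_cong[OF _ assms(2) eq]
  show ?thesis
    using assms(1) unfolding regular_germ_def crossing_germ_def prod.case f0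
    by (elim disj_forward conj_forward) (assumption | erule concat interior)+
qed

lemma smooth_germ_signs:
  assumes F: "F = X \<or> F = Y" and g: "g 0 \<in> V" "smooth_germ F g"
  shows "\<exists>e>0. solves F {-e<..<e} g \<and> (\<forall>s\<in>{-e<..<e} - {0}. g s \<in> U \<and>
    (\<forall>i. sgn (g s $ i) = (if g 0 $ i \<noteq> 0 then sgn (g 0 $ i) else sgn s * sgn (v $ i))))"
proof -
  obtain d where d: "d > 0" "solves F {-d<..<d} g" using g(2) by (auto simp: smooth_germ_def)
  have der: "(g has_vector_derivative F (g 0)) (at 0)" using d solves_open_iff by auto
  have dir: "sgn (F (g 0) $ i) = sgn (v $ i)" for i using F g(1) dir_X dir_Y by blast
  then have nz: "F (g 0) $ i \<noteq> 0" for i using v_nz[of i] by (metis sgn_eq_0_iff)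
  have "\<forall>\<^sub>F s in at 0. \<forall>i. sgn (g s $ i) = (if g 0 $ i \<noteq> 0 then sgn (g 0 $ i) else sgn s * sgn (v $ i))"
    using component_sign_near[OF der nz] unfolding dir by (intro eventually_all_finite) auto
  then obtain \<epsilon> where \<epsilon>: "\<epsilon> > 0" "\<forall>s\<in>UNIV. s \<noteq> 0 \<and> dist s 0 < \<epsilon> \<longrightarrow>
      (\<forall>i. sgn (g s $ i) = (if g 0 $ i \<noteq> 0 then sgn (g 0 $ i) else sgn s * sgn (v $ i)))"
    unfolding eventually_at by (elim exE conjE)
  obtain \<eta> where \<eta>: "\<eta> > 0" "\<forall>s\<in>{-\<eta><..<\<eta>}. g s \<in> V"
    using smooth_germ_continuous_near[OF g(2) open_V g(1)] by blast
  show ?thesis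
  proof (intro exI[of _ "min d (min \<epsilon> \<eta>)"] conjI ballI)
    show "solves F {-min d (min \<epsilon> \<eta>)<..<min d (min \<epsilon> \<eta>)} g"
      by (rule solves_subset[OF d(2)]) (use symmetric_interval_min(1) in blast)
    fix s assume s: "s \<in> {-min d (min \<epsilon> \<eta>)<..<min d (min \<epsilon> \<eta>)} - {0}"
    then have "s \<in> {-min \<epsilon> \<eta><..<min \<epsilon> \<eta>}" using symmetric_interval_min(2) by blast
    note s' = symmetric_interval_min[OF this]
    show "g s \<in> U" using \<eta>(2) s'(2) V_sub by blast
    have "dist s 0 < \<epsilon>" using s'(1) by (auto simp: dist_real_def)
    then show "\<forall>i. sgn (g s $ i) = (if g 0 $ i \<noteq> 0 then sgn (g 0 $ i) else sgn s * sgn (v $ i))"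
      using \<epsilon>(2) s by blast
  qed (use d \<epsilon> \<eta> in auto)
qed

text \<open>Just after leaving \<open>p\<close>, and just before reaching it, the coordinates of a solution have signs that depend
  only on \<open>p\<close> and \<open>v\<close>, not on which of the two fields is followed.  These signs decide which field
  governs each half of the trajectory, and the two halves are joined at \<open>p\<close>.\<close>

lemma exists_regular_germ:
  assumes p: "p \<in> V"
  shows "\<exists>g. g 0 = p \<and> regular_germ g"
proof -
  \<comment> \<open>\<open>side 1\<close> and \<open>side (-1)\<close> are the coordinate signs just after and just before time \<open>0\<close>; the sign
    \<open>\<pi>\<close> of their product tells \<open>Upos\<close> from \<open>Uneg\<close>.\<close>
  define side where "side \<sigma> i = (if p $ i \<noteq> 0 then sgn (p $ i) else \<sigma> * sgn (v $ i))" for \<sigma> and i :: 2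
  define \<pi> where "\<pi> \<sigma> = side \<sigma> 1 * side \<sigma> 2" for \<sigma>
  define A where "A x = (if x > 0 then Upos U else Uneg U)" for x :: real
  define F where "F x = (if x > 0 then X else Y)" for x :: real
  have sv: "sgn (v $ i) \<noteq> 0" for i using v_nz by (simp add: sgn_zero_iff)
  have \<pi>_nz: "\<pi> \<sigma> \<noteq> 0" if "\<sigma> \<noteq> 0" for \<sigma> using that sv by (simp add: \<pi>_def side_def sgn_zero_iff)
  have half: "\<exists>g e. g 0 = p \<and> e > 0 \<and> solves (F (\<pi> \<sigma>)) {-e<..<e} g \<and>
      (\<forall>s\<in>{-e<..<e} - {0}. sgn s = \<sigma> \<longrightarrow> g s \<in> A (\<pi> \<sigma>))" if \<sigma>: "\<sigma> \<noteq> 0" for \<sigma>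
  proof -
    obtain g where g: "g 0 = p" "smooth_germ (F (\<pi> \<sigma>)) g"
      using sol_X[OF p] sol_Y[OF p] unfolding F_def by (cases "\<pi> \<sigma> > 0") auto
    have FXY: "F (\<pi> \<sigma>) = X \<or> F (\<pi> \<sigma>) = Y" by (simp add: F_def)
    obtain e where e: "e > 0" "solves (F (\<pi> \<sigma>)) {-e<..<e} g" "\<forall>s\<in>{-e<..<e} - {0}. g s \<in> U \<and>
        (\<forall>i. sgn (g s $ i) = (if g 0 $ i \<noteq> 0 then sgn (g 0 $ i) else sgn s * sgn (v $ i)))"
      using smooth_germ_signs[OF FXY _ g(2)] g(1) p by auto
    have "g s \<in> A (\<pi> \<sigma>)" if s: "s \<in> {-e<..<e} - {0}" "sgn s = \<sigma>" for s
    proof -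
      have "g s \<in> U" "sgn (g s $ i) = side \<sigma> i" for i
        using e(3) s g(1) unfolding side_def by auto
      then have "sgn (g s $ 1 * g s $ 2) = \<pi> \<sigma>" by (simp add: sgn_mult \<pi>_def)
      then have "\<pi> \<sigma> > 0 \<longleftrightarrow> g s $ 1 * g s $ 2 > 0" "\<pi> \<sigma> < 0 \<longleftrightarrow> g s $ 1 * g s $ 2 < 0"
        by (metis sgn_greater, metis sgn_less)
      then show ?thesis using \<open>g s \<in> U\<close> \<pi>_nz[OF \<sigma>] by (auto simp: A_def Upos_def Uneg_def)
    qed
    then show ?thesis using g(1) e(1,2) by blast
  qed
  have govern_concat: "\<exists>g. g 0 = p \<and> concat_germ (F (\<pi> (-1))) (A (\<pi> (-1))) (F (\<pi> 1)) (A (\<pi> 1)) g"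
  proof -
    obtain g1 e1 where g1: "g1 0 = p" "e1 > 0" "solves (F (\<pi> (-1))) {-e1<..<e1} g1"
      "\<forall>s\<in>{-e1<..<e1} - {0}. sgn s = -1 \<longrightarrow> g1 s \<in> A (\<pi> (-1))" using half[of "-1"] by auto
    obtain g2 e2 where g2: "g2 0 = p" "e2 > 0" "solves (F (\<pi> 1)) {-e2<..<e2} g2"
      "\<forall>s\<in>{-e2<..<e2} - {0}. sgn s = 1 \<longrightarrow> g2 s \<in> A (\<pi> 1)" using half[of 1] by auto
    define g where "g s = (if s \<le> 0 then g1 s else g2 s)" for s
    define e where "e = min e1 e2"
    have "e > 0" using g1 g2 by (simp add: e_def)
    have sub: "s \<in> {-e1<..<e1}" "s \<in> {-e2<..<e2}" if "s \<in> {-e<..<e}" for s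
      using that symmetric_interval_min unfolding e_def by blast+
    have "g ` {-e<..<0} \<subseteq> A (\<pi> (-1))" "g ` {0<..<e} \<subseteq> A (\<pi> 1)"
      using g1(4) g2(4) sub \<open>e > 0\<close> by (auto simp: g_def)
    moreover have "solves (F (\<pi> (-1))) {-e<..0} g"
    proof (rule solves_cong)
      show "solves (F (\<pi> (-1))) {-e<..0} g1"
        by (rule solves_subset[OF g1(3)]) (use sub(1) \<open>e > 0\<close> in auto)
    qed (simp add: g_def)
    moreover have "solves (F (\<pi> 1)) {0..<e} g"
    proof (rule solves_cong)
      show "solves (F (\<pi> 1)) {0..<e} g2"
        by (rule solves_subset[OF g2(3)]) (use sub(2) \<open>e > 0\<close> in auto)
    qed (use g1(1) g2(1) in \<open>auto simp: g_def\<close>)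
    ultimately have "concat_germ (F (\<pi> (-1))) (A (\<pi> (-1))) (F (\<pi> 1)) (A (\<pi> 1)) g"
      unfolding concat_germ_def using \<open>e > 0\<close> by blast
    then show ?thesis using g1(1) by (intro exI[of _ g]) (simp add: g_def)
  qed
  consider "p $ 1 \<noteq> 0" "p $ 2 \<noteq> 0" | "p $ 1 = 0" "p $ 2 = 0" | i j where "p $ i = 0" "p $ j \<noteq> 0"
    by blast
  then show ?thesis
  proof cases
    case 1
    obtain g1 e1 where g1: "g1 0 = p" "e1 > 0" "solves (F (\<pi> 1)) {-e1<..<e1} g1"
      using half[of 1] by auto
    have "\<pi> 1 = sgn (p $ 1 * p $ 2)" using 1 by (simp add: \<pi>_def side_def sgn_mult)
    then have pA: "p \<in> interior (A (\<pi> 1))"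
    proof -
      assume "\<pi> 1 = sgn (p $ 1 * p $ 2)"
      moreover have "open {q::plane. q $ 1 * q $ 2 > 0}" "open {q::plane. q $ 1 * q $ 2 < 0}"
        by (intro open_Collect_less continuous_intros)+
      then have "open (V \<inter> {q. q $ 1 * q $ 2 > 0})" "open (V \<inter> {q. q $ 1 * q $ 2 < 0})"
        using open_V by auto
      moreover have "p $ 1 * p $ 2 > 0 \<or> p $ 1 * p $ 2 < 0" using 1 by (simp add: linorder_neq_iff[symmetric])
      ultimately show ?thesis using p V_sub unfolding A_def interior_def
        by (auto simp: Upos_def Uneg_def)
    qed
    have "smooth_germ (F (\<pi> 1)) g1" using g1 by (auto simp: smooth_germ_def)
    from smooth_germ_continuous_near[OF this open_interior] g1(1) pA
    obtain d where d: "d > 0" "\<forall>s\<in>{-d<..<d}. g1 s \<in> interior (A (\<pi> 1))" by metis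
    let ?m = "min d e1"
    have "g1 ` {-?m<..<?m} \<subseteq> A (\<pi> 1)"
      using d(2) symmetric_interval_min(1)[of _ d e1] interior_subset by blast
    moreover have "solves (F (\<pi> 1)) {-?m<..<?m} g1"
      by (rule solves_subset[OF g1(3)]) (use symmetric_interval_min(2) in blast)
    moreover have "?m > 0" using d(1) g1(2) by simp
    ultimately have "interior_germ U (X, Y) g1"
      unfolding interior_germ_def A_def F_def by (cases "\<pi> 1 > 0") auto
    then show ?thesis using g1(1) unfolding regular_germ_def by blast
  next
    case 2
    then have "p = 0" by (simp add: vec_eq_iff forall_2)
    moreover have "\<pi> (-1) = \<pi> 1" using 2 by (simp add: \<pi>_def side_def)
    ultimately show ?thesis using govern_concat unfolding regular_germ_def F_def A_def
      by (cases "\<pi> 1 > 0") auto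
  next
    case 3
    then have ij: "i = 1 \<and> j = 2 \<or> i = 2 \<and> j = 1" using exhaust_2[of i] exhaust_2[of j] by auto
    then have "\<pi> (-1) = - \<pi> 1" using 3 by (auto simp: \<pi>_def side_def)
    moreover have "p \<in> Crossing U (X, Y) i"
      by (rule crossing_all[OF p]) (use 3 p V_sub in \<open>auto simp: Axis_def\<close>)
    moreover have "p \<noteq> 0" using 3 by auto
    ultimately show ?thesis using govern_concat \<pi>_nz[of 1]
      unfolding regular_germ_def crossing_germ_def F_def A_def
      by (cases "\<pi> 1 > 0") auto
  qed
qed

text \<open>For the converse direction, compare a straight germ with the trajectory germ through the same point: both
  have the same image under the injective map \<open>h\<close>, so they agree near time \<open>0\<close>, and the rule only looks
  at times near \<open>0\<close>.\<close>

theorem trajectory_germ_iff_straight: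
  assumes g0: "g 0 \<in> V"
  shows "trajectory_germ U (X, Y) g \<longleftrightarrow> straight g"
proof -
  have "regular_germ g" if g: "straight g"
  proof -
    obtain f where f: "f 0 = g 0" "regular_germ f"
      using exists_regular_germ[OF g0] by (elim exE conjE)
    have "f 0 \<in> V" unfolding f(1) by (rule g0)
    from regular_germ_straight[OF f(2) this]
    obtain d where d: "d > 0" "\<forall>s\<in>{-d<..<d}. f s \<in> V \<and> h (f s) = h (f 0) + s *\<^sub>R v"
      unfolding straight_def by (elim exE conjE)
    from g obtain e where e: "e > 0" "\<forall>s\<in>{-e<..<e}. g s \<in> V \<and> h (g s) = h (g 0) + s *\<^sub>R v"
      unfolding straight_def by (elim exE conjE)
    have "min d e > 0" using d(1) e(1) by simp
    moreover have "g s = f s" if s: "s \<in> {-min d e<..<min d e}" for s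
    proof (rule inj_onD[OF inj_h])
      note fs = bspec[OF d(2) symmetric_interval_min(1)[OF s]]
      note gs = bspec[OF e(2) symmetric_interval_min(2)[OF s]]
      show "g s \<in> V" by (rule conjunct1[OF gs])
      show "f s \<in> V" by (rule conjunct1[OF fs])
      show "h (g s) = h (f s)" by (simp only: conjunct2[OF fs] conjunct2[OF gs] f(1))
    qed
    ultimately show ?thesis by (rule regular_germ_cong[OF f(2)])
  qed
  then show ?thesis
    unfolding trajectory_germ_iff_regular[of g, OF g0]
    using regular_germ_straight[of g, OF _ g0] by (intro iffI)
qed

end


section \<open>Transport of maximal curves\<close>

lemma smooth_germ_const_iff:
  "smooth_germ (\<lambda>p. v) g \<longleftrightarrow> (\<exists>e>0. \<forall>s\<in>{-e<..<e}. g s = g 0 + s *\<^sub>R v)"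
proof
  assume "smooth_germ (\<lambda>p. v) g"
  then obtain e where e: "e > 0" "solves (\<lambda>p. v) {-e<..<e} g" by (auto simp: smooth_germ_def)
  have bound: "norm ((g s - s *\<^sub>R v) - (g 0 - 0 *\<^sub>R v)) \<le> 0 * \<bar>s - 0\<bar>" if "s \<in> {-e<..<e}" for s
  proof (rule vector_mean_value_bound[where f="\<lambda>s. g s - s *\<^sub>R v" and K="{-e<..<e}" and f'="\<lambda>_. v - v"])
    show "((\<lambda>s. g s - s *\<^sub>R v) has_vector_derivative v - v) (at t within {-e<..<e})"
      if "t \<in> {-e<..<e}" for t
      using e(2) that unfolding solves_def
      by (intro has_vector_derivative_diff) (auto intro!: derivative_eq_intros)
  qed (use that e(1) in auto)
  have "g s = g 0 + s *\<^sub>R v" if "s \<in> {-e<..<e}" for s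
    using bound[OF that] by (simp add: algebra_simps)
  then show "\<exists>e>0. \<forall>s\<in>{-e<..<e}. g s = g 0 + s *\<^sub>R v" using e(1) by blast
next
  assume "\<exists>e>0. \<forall>s\<in>{-e<..<e}. g s = g 0 + s *\<^sub>R v"
  then obtain e where e: "e > 0" "\<And>s. s \<in> {-e<..<e} \<Longrightarrow> g s = g 0 + s *\<^sub>R v" by blast
  have "solves (\<lambda>p. v) {-e<..<e} (\<lambda>s. g 0 + s *\<^sub>R v)"
    unfolding solves_def by (auto intro!: derivative_eq_intros)
  then have "solves (\<lambda>p. v) {-e<..<e} g" by (rule solves_cong) (rule e(2))
  then show "smooth_germ (\<lambda>p. v) g" using e(1) unfolding smooth_germ_def by blast
qed

text \<open>Two local rules that both amount to uniform motion with velocity \<open>v\<close>, the first one after applying \<open>h\<close>.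
  Then \<open>h\<close> matches the curves of the two rules without any change of time, and with them the maximal
  ones, whatever the shape of \<open>V\<close>.\<close>

locale germ_conjugacy =
  fixes V V' :: "plane set" and h h' :: "plane \<Rightarrow> plane" and P P' :: "germ \<Rightarrow> bool" and v :: plane
  assumes hom: "homeomorphism V V' h h'"
    and P_iff: "g 0 \<in> V \<Longrightarrow>
      P g \<longleftrightarrow> (\<exists>e>0. \<forall>s\<in>{-e<..<e}. g s \<in> V \<and> h (g s) = h (g 0) + s *\<^sub>R v)"
    and P'_iff: "g 0 \<in> V' \<Longrightarrow>
      P' g \<longleftrightarrow> (\<exists>e>0. \<forall>s\<in>{-e<..<e}. g s \<in> V' \<and> g s = g 0 + s *\<^sub>R v)"
begin

lemma h_in: "p \<in> V \<Longrightarrow> h p \<in> V'" and h'_in: "q \<in> V' \<Longrightarrow> h' q \<in> V"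
  and h'_h: "p \<in> V \<Longrightarrow> h' (h p) = p" and h_h': "q \<in> V' \<Longrightarrow> h (h' q) = q"
  using hom unfolding homeomorphism_def by auto

lemma rule_curves_iff:
  assumes in_V: "\<gamma> ` I \<subseteq> V" and \<delta>: "\<And>t. t \<in> I \<Longrightarrow> \<delta> t = h (\<gamma> t)"
  shows "(I, \<gamma>) \<in> rule_curves P V \<longleftrightarrow> (I, \<delta>) \<in> rule_curves P' V'"
proof -
  have in_V': "\<delta> ` I \<subseteq> V'" using in_V \<delta> h_in by auto
  have "P (\<lambda>s. \<gamma> (t + s)) \<longleftrightarrow> P' (\<lambda>s. \<delta> (t + s))" if I: "open I" "t \<in> I" for t
  proof -
    obtain d where d: "d > 0" "ball t d \<subseteq> I" using I open_contains_ball by blast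
    have near: "t + s \<in> I" if "s \<in> {-d<..<d}" for s
      using d(2) that by (auto simp: subset_iff dist_norm)
    let ?Q = "\<lambda>s. \<gamma> (t + s) \<in> V \<and> h (\<gamma> (t + s)) = h (\<gamma> (t + 0)) + s *\<^sub>R v"
    let ?Q' = "\<lambda>s. \<delta> (t + s) \<in> V' \<and> \<delta> (t + s) = \<delta> (t + 0) + s *\<^sub>R v"
    have Q: "?Q s \<longleftrightarrow> ?Q' s" if "s \<in> {-d<..<d}" for s
    proof -
      have "\<gamma> (t + s) \<in> V" "\<delta> (t + s) \<in> V'" "\<delta> (t + s) = h (\<gamma> (t + s))" "\<delta> (t + 0) = h (\<gamma> (t + 0))"
        using near[OF that] I(2) in_V in_V' \<delta> by auto
      then show ?thesis by (simp only: simp_thms)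
    qed
    \<comment> \<open>\<open>\<gamma>\<close> and \<open>\<delta>\<close> are related only on \<open>I\<close>, so times are first restricted to a neighborhood inside \<open>I\<close>.\<close>
    have ev: "(\<exists>e>0. \<forall>s\<in>{-e<..<e}. R s) \<longleftrightarrow> (\<exists>e>0. \<forall>s\<in>{-min d e<..<min d e}. R s)" for R :: "real \<Rightarrow> bool"
    proof
      assume "\<exists>e>0. \<forall>s\<in>{-e<..<e}. R s"
      then obtain e where "e > 0" "\<forall>s\<in>{-e<..<e}. R s" by blast
      then show "\<exists>e>0. \<forall>s\<in>{-min d e<..<min d e}. R s"
        using symmetric_interval_min(2) by (intro exI[of _ e]) blast
    next
      assume "\<exists>e>0. \<forall>s\<in>{-min d e<..<min d e}. R s"
      then obtain e where "e > 0" "\<forall>s\<in>{-min d e<..<min d e}. R s" by blast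
      then show "\<exists>e>0. \<forall>s\<in>{-e<..<e}. R s" using d(1) by (intro exI[of _ "min d e"]) simp
    qed
    have "(\<exists>e>0. \<forall>s\<in>{-e<..<e}. ?Q s) \<longleftrightarrow> (\<exists>e>0. \<forall>s\<in>{-e<..<e}. ?Q' s)"
      unfolding ev[of ?Q] ev[of ?Q']
    proof (rule ex_cong1, rule conj_cong[OF refl], rule ball_cong[OF refl])
      fix e s :: real assume "s \<in> {-min d e<..<min d e}"
      then show "?Q s \<longleftrightarrow> ?Q' s" by (rule Q[OF symmetric_interval_min(1)])
    qed
    moreover have "\<gamma> (t + 0) \<in> V" "\<delta> (t + 0) \<in> V'" using I(2) in_V in_V' by auto
    ultimately show ?thesis
      using P_iff[of "\<lambda>s. \<gamma> (t + s)"] P'_iff[of "\<lambda>s. \<delta> (t + s)"] by (simp only: simp_thms)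
  qed
  then show ?thesis using in_V in_V' unfolding rule_curves_def by auto
qed

lemma maximal_curves_iff:
  assumes in_V: "\<gamma> ` I \<subseteq> V" and \<delta>: "\<And>t. t \<in> I \<Longrightarrow> \<delta> t = h (\<gamma> t)"
  shows "(I, \<gamma>) \<in> maximal_curves P V \<longleftrightarrow> (I, \<delta>) \<in> maximal_curves P' V'"
proof -
  have ext_P: "I' = I"
    if max: "\<forall>I' \<delta>'. (I', \<delta>') \<in> rule_curves P' V' \<longrightarrow> I \<subseteq> I' \<and> (\<forall>t\<in>I. \<delta>' t = \<delta> t) \<longrightarrow> I' = I"
      and r: "(I', \<gamma>') \<in> rule_curves P V" and I': "I \<subseteq> I'" and ext: "\<forall>t\<in>I. \<gamma>' t = \<gamma> t" for I' \<gamma>'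
  proof -
    have "\<gamma>' ` I' \<subseteq> V" using r by (simp add: rule_curves_def)
    then have "(I', \<lambda>t. h (\<gamma>' t)) \<in> rule_curves P' V'"
      using rule_curves_iff[of \<gamma>' I' "\<lambda>t. h (\<gamma>' t)"] r by (simp only: simp_thms)
    moreover have "\<forall>t\<in>I. h (\<gamma>' t) = \<delta> t"
    proof
      fix t assume "t \<in> I"
      then show "h (\<gamma>' t) = \<delta> t" by (simp only: bspec[OF ext] \<delta>)
    qed
    ultimately show "I' = I" by (intro max[rule_format] conjI I')
  qed
  have ext_P': "I' = I"
    if max: "\<forall>I' \<gamma>'. (I', \<gamma>') \<in> rule_curves P V \<longrightarrow> I \<subseteq> I' \<and> (\<forall>t\<in>I. \<gamma>' t = \<gamma> t) \<longrightarrow> I' = I"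
      and r: "(I', \<delta>') \<in> rule_curves P' V'" and I': "I \<subseteq> I'" and ext: "\<forall>t\<in>I. \<delta>' t = \<delta> t" for I' \<delta>'
  proof -
    have V': "\<delta>' t \<in> V'" if "t \<in> I'" for t using r that by (auto simp: rule_curves_def)
    have "(I', \<lambda>t. h' (\<delta>' t)) \<in> rule_curves P V"
    proof (rule rule_curves_iff[THEN iffD2, OF _ _ r])
      show "(\<lambda>t. h' (\<delta>' t)) ` I' \<subseteq> V" using V' h'_in by blast
      show "\<delta>' t = h (h' (\<delta>' t))" if "t \<in> I'" for t using h_h'[OF V'[OF that]] ..
    qed
    moreover have "\<forall>t\<in>I. h' (\<delta>' t) = \<gamma> t"
    proof
      fix t assume t: "t \<in> I"
      then have "\<gamma> t \<in> V" using in_V by blast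
      then show "h' (\<delta>' t) = \<gamma> t" by (simp only: bspec[OF ext t] \<delta>[OF t] h'_h)
    qed
    ultimately show "I' = I" by (intro max[rule_format] conjI I')
  qed
  have max_iff: "(J, c) \<in> maximal_curves Q W \<longleftrightarrow> (J, c) \<in> rule_curves Q W \<and>
      (\<forall>J' c'. (J', c') \<in> rule_curves Q W \<longrightarrow> J \<subseteq> J' \<and> (\<forall>t\<in>J. c' t = c t) \<longrightarrow> J' = J)" for J c Q W
    by (simp add: maximal_curves_def Ball_def)
  have rules: "(I, \<gamma>) \<in> rule_curves P V \<longleftrightarrow> (I, \<delta>) \<in> rule_curves P' V'"
    by (rule rule_curves_iff[OF in_V \<delta>])
  show ?thesis
    unfolding max_iff rules
    by (rule conj_cong[OF refl], rule iffI)
       (intro allI impI, elim conjE, rule ext_P', assumption+,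
        intro allI impI, elim conjE, rule ext_P, assumption+)
qed

lemma maps_curves_same_time:
  assumes "\<And>I \<gamma>. (I, \<gamma>) \<in> T \<Longrightarrow> (I, \<lambda>t. f (\<gamma> t)) \<in> T'"
  shows "maps_curves f T T'"
  unfolding maps_curves_def
proof (rule ballI, rule case_prodI2)
  fix x I \<gamma> assume "x \<in> T" "x = (I, \<gamma>)"
  then have "(I, \<lambda>t. f (\<gamma> t)) \<in> T'" using assms by simp
  moreover have "strict_mono_on I (\<lambda>t. t) \<and> (\<lambda>t. t) ` I = I \<and> (\<forall>t\<in>I. f (\<gamma> t) = f (\<gamma> t))"
    by (simp add: strict_mono_onI)
  ultimately show "\<exists>(J, \<delta>)\<in>T'. \<exists>\<tau>::real \<Rightarrow> real.
      strict_mono_on I \<tau> \<and> \<tau> ` I = J \<and> (\<forall>t\<in>I. f (\<gamma> t) = \<delta> (\<tau> t))"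
    by (intro bexI[of _ "(I, \<lambda>t. f (\<gamma> t))"] case_prodI exI[of _ "\<lambda>t. t"])
qed

lemma maps_maximal_curves:
  "maps_curves h (maximal_curves P V) (maximal_curves P' V')"
  "maps_curves h' (maximal_curves P' V') (maximal_curves P V)"
proof -
  have range: "\<gamma> ` I \<subseteq> W" if "(I, \<gamma>) \<in> maximal_curves Q W" for I \<gamma> Q W
    using that by (simp add: maximal_curves_def rule_curves_def)
  show "maps_curves h (maximal_curves P V) (maximal_curves P' V')"
  proof (rule maps_curves_same_time)
    fix I \<gamma> assume m: "(I, \<gamma>) \<in> maximal_curves P V"
    show "(I, \<lambda>t. h (\<gamma> t)) \<in> maximal_curves P' V'"
      by (rule maximal_curves_iff[OF range[OF m] refl, THEN iffD1, OF m])
  qed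
  show "maps_curves h' (maximal_curves P' V') (maximal_curves P V)"
  proof (rule maps_curves_same_time)
    fix I \<delta> assume m: "(I, \<delta>) \<in> maximal_curves P' V'"
    have V': "\<delta> t \<in> V'" if "t \<in> I" for t using range[OF m] that by blast
    show "(I, \<lambda>t. h' (\<delta> t)) \<in> maximal_curves P V"
    proof (rule maximal_curves_iff[THEN iffD2, OF _ _ m])
      show "(\<lambda>t. h' (\<delta> t)) ` I \<subseteq> V" using V' h'_in by blast
      show "\<delta> t = h (h' (\<delta> t))" if "t \<in> I" for t using h_h'[OF V'[OF that]] ..
    qed
  qed
qed

end


section \<open>Orientation\<close>

lemma to_complex_of_complex_plane [simp]: "to_complex (of_complex_plane z) = z"
  by (simp add: to_complex_def of_complex_plane_def)

lemma of_complex_plane_to_complex [simp]: "of_complex_plane (to_complex p) = p"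
  by (simp add: to_complex_def of_complex_plane_def vec_eq_iff forall_2)

lemma norm_to_complex [simp]: "norm (to_complex p) = norm p"
  by (simp add: to_complex_def cmod_def norm_eq_sqrt_inner inner_vec_def sum_2 power2_eq_square)

lemma norm_of_complex_plane [simp]: "norm (of_complex_plane z) = norm z"
  by (metis norm_to_complex to_complex_of_complex_plane)

lemma linear_to_complex: "linear to_complex"
  by (rule linearI) (simp_all add: to_complex_def complex_eq_iff)

lemma linear_of_complex_plane: "linear of_complex_plane"
  by (rule linearI) (simp_all add: of_complex_plane_def vec_eq_iff forall_2)

lemma continuous_on_to_complex [continuous_intros]:
  "continuous_on S f \<Longrightarrow> continuous_on S (\<lambda>x. to_complex (f x))"
  using bounded_linear.continuous_on linear_to_complex by (auto simp: linear_conv_bounded_linear)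

lemma continuous_on_of_complex_plane [continuous_intros]:
  "continuous_on S f \<Longrightarrow> continuous_on S (\<lambda>x. of_complex_plane (f x))"
  using bounded_linear.continuous_on linear_of_complex_plane by (auto simp: linear_conv_bounded_linear)

text \<open>Moving a disc inside the convex domain to one around the origin, and rescaling it on the way, moves the
  image of its boundary circle along without ever meeting the image of the centre, by injectivity, so
  the winding number does not change.  Around the origin \<open>h\<close> keeps every point in its closed quadrant, so the segment from \<open>h q\<close>
  to \<open>q\<close> avoids \<open>0\<close> and the circle may be deformed to itself.\<close>

lemma orientation_preserving_if_sgn:
  assumes cont: "continuous_on (ball 0 R) h" and inj: "inj_on h (ball 0 R)" and "R > 0"
    and sgn: "\<And>p i. p \<in> ball 0 R \<Longrightarrow> sgn (h p $ i) = sgn (p $ i)"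
  shows "orientation_preserving_on (ball 0 R) h"
  unfolding orientation_preserving_on_def
proof (intro ballI allI impI)
  fix p :: plane and r :: real
  assume p: "p \<in> ball 0 R" and r: "r > 0" "cball p r \<subseteq> ball 0 R"
  define f where "f z = to_complex (h (of_complex_plane z))" for z
  define D where "D = ball (0::complex) R"
  define z where "z = to_complex p"
  have zD: "z \<in> D" using p by (simp add: z_def D_def)
  have cbD: "cball z r \<subseteq> D"
  proof
    fix w assume "w \<in> cball z r"
    then have "norm (p - of_complex_plane w) \<le> r"
      using norm_to_complex[of "p - of_complex_plane w"]
      by (simp add: z_def dist_norm linear_diff[OF linear_to_complex])
    then have "of_complex_plane w \<in> cball p r" by (simp add: dist_norm)
    then have "of_complex_plane w \<in> ball 0 R" using r(2) by blast
    then show "w \<in> D" by (simp add: D_def)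
  qed
  have fcont: "continuous_on D f"
    unfolding f_def
    by (intro continuous_on_to_complex continuous_on_compose2[OF cont]
        continuous_on_of_complex_plane continuous_on_id) (auto simp: D_def)
  have finj: "f x = f y \<longleftrightarrow> x = y" if "x \<in> D" "y \<in> D" for x y
  proof
    assume "f x = f y"
    then have "h (of_complex_plane x) = h (of_complex_plane y)"
      unfolding f_def by (metis of_complex_plane_to_complex)
    then have "of_complex_plane x = of_complex_plane y"
      using inj_onD[OF inj] that by (simp add: D_def)
    then show "x = y" by (metis to_complex_of_complex_plane)
  qed simp
  have "h 0 = 0" using sgn[of 0] \<open>R > 0\<close> by (simp add: vec_eq_iff sgn_zero_iff)
  then have f0: "f 0 = 0"
    by (simp add: f_def linear_0[OF linear_of_complex_plane] linear_0[OF linear_to_complex])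
  have fsgn: "sgn (Re (f w)) = sgn (Re w)" "sgn (Im (f w)) = sgn (Im w)" if "w \<in> D" for w
    using sgn[of "of_complex_plane w" 1] sgn[of "of_complex_plane w" 2] that
    by (simp_all add: f_def D_def to_complex_def) (simp_all add: of_complex_plane_def)
  define r0 where "r0 = R / 2"
  have "r0 > 0" "cball 0 r0 \<subseteq> D" using \<open>R > 0\<close> by (auto simp: r0_def D_def)
  have on_circle: "circlepath c \<rho> t - c = of_real \<rho> * exp (2 * of_real pi * \<i> * of_real t)" for c \<rho> t
    by (simp add: circlepath_def part_circlepath_def linepath_def)
      (simp add: algebra_simps)
  have circle_in: "circlepath c \<rho> t \<in> cball c \<rho>" if "\<rho> > 0" for c \<rho> t
    using arg_cong[OF on_circle[of c \<rho> t], of norm] that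
    by (simp add: dist_norm norm_minus_commute norm_mult)
  have unit: "circlepath c \<rho> t = c + of_real \<rho> * exp (2 * of_real pi * \<i> * of_real t)" for c \<rho> t
    using on_circle[of c \<rho> t] by (simp add: algebra_simps)
  have "winding_number (\<lambda>t. f (circlepath z r t)) (f z) =
        winding_number (\<lambda>t. f (circlepath z r t) - f z) 0"
    by (rule winding_number_offset)
  also have "\<dots> = winding_number (\<lambda>t. f (circlepath 0 r0 t)) 0"
  proof (rule winding_number_homotopic_loops)
    \<comment> \<open>Centre and radius of the moving circle; by \<open>circ\<close> below each of its points is a convex combination of
      points of the first and the last circle, so it stays in the domain.\<close>
    define c where "c s = of_real (1 - s) * z" for s :: real
    define \<rho> where "\<rho> s = (1 - s) * r + s * r0" for s :: real
    have \<rho>_pos: "\<rho> s > 0" if "s \<in> {0..1}" for s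
    proof (cases "s = 0")
      case False
      then have "s * r0 > 0" using that \<open>r0 > 0\<close> by simp
      moreover have "(1 - s) * r \<ge> 0" using that r(1) by simp
      ultimately show ?thesis by (simp add: \<rho>_def)
    qed (use r(1) in \<open>simp add: \<rho>_def\<close>)
    have circ: "circlepath (c s) (\<rho> s) t = (1 - s) *\<^sub>R circlepath z r t + s *\<^sub>R circlepath 0 r0 t" for s t
      unfolding unit by (simp add: c_def \<rho>_def scaleR_conv_of_real algebra_simps)
    have cD: "c s \<in> D" if "s \<in> {0..1}" for s
    proof -
      have "c s = (1 - s) *\<^sub>R z + s *\<^sub>R 0" by (simp add: c_def scaleR_conv_of_real)
      then show ?thesis
        using convexD_alt[OF convex_ball[of "0::complex" R], of z 0 s] zD that \<open>R > 0\<close> by (simp add: D_def)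
    qed
    have circD: "circlepath (c s) (\<rho> s) t \<in> D" if "s \<in> {0..1}" for s t
    proof -
      have "circlepath z r t \<in> D" using circle_in[OF r(1)] cbD by blast
      moreover have "circlepath 0 r0 t \<in> D"
        using circle_in[OF \<open>r0 > 0\<close>] \<open>cball 0 r0 \<subseteq> D\<close> by blast
      ultimately show ?thesis
        using convexD_alt[OF convex_ball[of "0::complex" R], of "circlepath z r t" "circlepath 0 r0 t" s] that
        unfolding circ D_def by simp
    qed
    have circ_ne: "circlepath (c s) (\<rho> s) t \<noteq> c s" if "s \<in> {0..1}" for s t
      using \<rho>_pos[OF that] by (simp add: unit)
    show "homotopic_loops (- {0}) (\<lambda>t. f (circlepath z r t) - f z) (\<lambda>t. f (circlepath 0 r0 t))"
      unfolding homotopic_loops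
    proof (intro exI conjI ballI)
      let ?H = "\<lambda>(s, t). f (circlepath (c s) (\<rho> s) t) - f (c s)"
      have "continuous_on ({0..1} \<times> {0..1}) (\<lambda>x. f (circlepath (c (fst x)) (\<rho> (fst x)) (snd x)) - f (c (fst x)))"
      proof (intro continuous_on_diff continuous_on_compose2[OF fcont])
        show "continuous_on ({0..1} \<times> {0..1}) (\<lambda>x. circlepath (c (fst x)) (\<rho> (fst x)) (snd x))"
          unfolding unit c_def \<rho>_def by (intro continuous_intros)
        show "continuous_on ({0..1} \<times> {0..1}) (\<lambda>x::real \<times> real. c (fst x))"
          unfolding c_def by (intro continuous_intros)
      qed (use circD cD in auto)
      then show "continuous_on ({0..1} \<times> {0..1}) ?H" by (simp add: case_prod_unfold)
      show "?H \<in> {0..1} \<times> {0..1} \<rightarrow> - {0}"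
      proof (clarsimp)
        fix s t :: real assume "0 \<le> s" "s \<le> 1" "f (circlepath (c s) (\<rho> s) t) = f (c s)"
        then show False using finj[OF circD cD, of s s t] circ_ne[of s t] by simp
      qed
      show "?H (0, t) = f (circlepath z r t) - f z" if "t \<in> {0..1}" for t
        by (simp add: c_def \<rho>_def)
      show "?H (1, t) = f (circlepath 0 r0 t)" if "t \<in> {0..1}" for t
        by (simp add: c_def \<rho>_def f0)
      show "pathfinish (?H \<circ> Pair s) = pathstart (?H \<circ> Pair s)" if "s \<in> {0..1}" for s
        by (simp add: pathfinish_def pathstart_def o_def unit)
    qed
  qed
  also have "\<dots> = winding_number (circlepath 0 r0) 0"
  proof (rule winding_number_homotopic_loops, rule homotopic_loops_linear)
    have circD: "circlepath 0 r0 t \<in> D" for t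
      using circle_in[OF \<open>r0 > 0\<close>] \<open>cball 0 r0 \<subseteq> D\<close> by blast
    show "path (\<lambda>t. f (circlepath 0 r0 t))"
      unfolding path_def
      by (rule continuous_on_compose2[OF fcont]) (use circD in \<open>auto simp: path_def[symmetric]\<close>)
    show "path (circlepath 0 r0)" by simp
    show "pathfinish (\<lambda>t. f (circlepath 0 r0 t)) = pathstart (\<lambda>t. f (circlepath 0 r0 t))"
      using pathfinish_circlepath[of 0 r0] pathstart_circlepath[of 0 r0]
      unfolding pathfinish_def pathstart_def by simp
    show "pathfinish (circlepath 0 r0) = pathstart (circlepath 0 r0)" by simp
    show "closed_segment (f (circlepath 0 r0 t)) (circlepath 0 r0 t) \<subseteq> - {0}" for t
    proof -
      let ?w = "circlepath 0 r0 t"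
      have "0 \<notin> closed_segment (f ?w) ?w"
      proof
        assume "0 \<in> closed_segment (f ?w) ?w"
        then obtain u where u: "0 \<le> u" "u \<le> 1" "0 = (1 - u) *\<^sub>R f ?w + u *\<^sub>R ?w"
          unfolding in_segment by (elim exE conjE)
        have zero: "b = 0" if eq: "0 = (1 - u) * a + u * b" and ab: "sgn a = sgn b" for a b :: real
        proof (rule ccontr)
          assume "b \<noteq> 0"
          have "sgn b * sgn b = 1" using \<open>b \<noteq> 0\<close> by (simp add: sgn_real_def)
          then have "sgn (a * b) = 1" by (simp only: sgn_mult ab)
          then have ab_pos: "a * b > 0" by (simp only: sgn_1_pos)
          have bb_pos: "b * b > 0" using \<open>b \<noteq> 0\<close> by (metis not_real_square_gt_zero)
          have "(1 - u) * (a * b) + u * (b * b) > 0"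
          proof (cases "u = 0")
            case False
            then have "u * (b * b) > 0" using u(1) bb_pos by simp
            moreover have "(1 - u) * (a * b) \<ge> 0" by (rule mult_nonneg_nonneg) (use u(2) ab_pos in simp_all)
            ultimately show ?thesis by linarith
          qed (use ab_pos in simp)
          moreover have "(1 - u) * (a * b) + u * (b * b) = ((1 - u) * a + u * b) * b"
            by (simp only: distrib_right mult.assoc)
          ultimately show False unfolding eq[symmetric] by simp
        qed
        have "0 = (1 - u) * Re (f ?w) + u * Re ?w"
          using arg_cong[OF u(3), of Re] by (simp only: zero_complex.sel plus_complex.sel scaleR_complex.sel)
        then have "Re ?w = 0" by (rule zero[OF _ fsgn(1)[OF circD]])
        moreover have "0 = (1 - u) * Im (f ?w) + u * Im ?w"
          using arg_cong[OF u(3), of Im] by (simp only: zero_complex.sel plus_complex.sel scaleR_complex.sel)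
        then have "Im ?w = 0" by (rule zero[OF _ fsgn(2)[OF circD]])
        ultimately have "?w = 0" by (simp add: complex_eq_iff)
        then show False using \<open>r0 > 0\<close> by (simp add: unit)
      qed
      then show ?thesis by (simp only: subset_Compl_singleton not_False_eq_True)
    qed
  qed
  also have "\<dots> = 1" using \<open>r0 > 0\<close> by (rule winding_number_circlepath_centre)
  finally show "winding_number (\<lambda>t. to_complex (h (of_complex_plane (circlepath (to_complex p) r t))))
      (to_complex (h p)) = 1"
    by (simp add: f_def z_def)
qed


section \<open>Local equivalence with the constant field\<close>

lemma Ck_on_continuous_on: "Ck_on k W F \<Longrightarrow> continuous_on W F"
  by (cases k) (auto intro!: continuous_at_imp_continuous_on differentiable_imp_continuous_within)

lemma Ck_on_const: "Ck_on k W (\<lambda>p. c)"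
  by (induction k arbitrary: c) simp_all

text \<open>The derivative is bounded near \<open>p0\<close> because its values on the two basis vectors are continuous.\<close>

lemma Ck_on_imp_lipschitz_near:
  assumes "Ck_on r W G" "r \<ge> 1" "open W" "p0 \<in> W"
  shows "\<exists>R>0. \<exists>L\<ge>0. \<forall>p\<in>ball p0 R. \<forall>q\<in>ball p0 R. norm (G p - G q) \<le> L * norm (p - q)"
proof -
  obtain k where k: "r = Suc k" using \<open>r \<ge> 1\<close> by (cases r) auto
  define D where "D x = frechet_derivative G (at x)" for x
  have diff: "(G has_derivative D x) (at x)" if "x \<in> W" for x
    using assms(1) that unfolding D_def by (simp add: k frechet_derivative_works)
  have contD: "continuous_on W (\<lambda>x. D x w)" for w
    using assms(1) unfolding D_def by (intro Ck_on_continuous_on[of k]) (simp add: k)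
  obtain R where R: "R > 0" "cball p0 R \<subseteq> W" using assms(3,4) open_contains_cball by blast
  have "\<forall>i. \<exists>B. \<forall>x\<in>cball p0 R. norm (D x (axis i 1)) \<le> B"
  proof
    fix i :: 2
    have "compact ((\<lambda>x. D x (axis i 1)) ` cball p0 R)"
      by (intro compact_continuous_image continuous_on_subset[OF contD R(2)] compact_cball)
    then have "bounded ((\<lambda>x. D x (axis i 1)) ` cball p0 R)" by (rule compact_imp_bounded)
    then show "\<exists>B. \<forall>x\<in>cball p0 R. norm (D x (axis i 1)) \<le> B"
      unfolding bounded_iff ball_simps(9) .
  qed
  from choice[OF this] obtain B where "\<forall>i. \<forall>x\<in>cball p0 R. norm (D x (axis i 1)) \<le> B i"
    by (elim exE)
  then have B: "norm (D x (axis i 1)) \<le> B i" if "x \<in> cball p0 R" for i x using that by simp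
  define L where "L = (\<Sum>i\<in>UNIV. B i)"
  have B_nonneg: "B i \<ge> 0" for i
  proof -
    have "norm (D p0 (axis i 1)) \<le> B i" by (rule B) (use R(1) in simp)
    then show ?thesis by (rule order_trans[OF norm_ge_zero])
  qed
  have onormD: "onorm (D x) \<le> L" if x: "x \<in> ball p0 R" for x
  proof (rule onorm_le)
    fix w :: plane
    have "x \<in> W" "x \<in> cball p0 R" using x R(2) by auto
    have lin: "linear (D x)" by (rule has_derivative_linear[OF diff[OF \<open>x \<in> W\<close>]])
    have "(\<Sum>i\<in>UNIV. (w $ i) *\<^sub>R axis i 1) = w"
      by (simp add: vec_eq_iff forall_2 sum_2 axis_def)
    then have "D x w = D x (\<Sum>i\<in>UNIV. (w $ i) *\<^sub>R axis i 1)" by (simp only:)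
    also have "\<dots> = (\<Sum>i\<in>UNIV. (w $ i) *\<^sub>R D x (axis i 1))"
      by (simp only: linear_sum[OF lin] linear_scale[OF lin])
    also have "norm \<dots> \<le> (\<Sum>i\<in>UNIV. norm w * B i)"
    proof (rule sum_norm_le)
      show "norm ((w $ i) *\<^sub>R D x (axis i 1)) \<le> norm w * B i" for i
        unfolding norm_scaleR
        by (rule mult_mono[OF component_le_norm_cart B[OF \<open>x \<in> cball p0 R\<close>]]) simp_all
    qed
    also have "\<dots> = L * norm w" unfolding L_def sum_distrib_left[symmetric] by (rule mult.commute)
    finally show "norm (D x w) \<le> L * norm w" .
  qed
  have "norm (G p - G q) \<le> L * norm (p - q)" if p: "p \<in> ball p0 R" and q: "q \<in> ball p0 R" for p q
  proof (rule differentiable_bound[where S="ball p0 R" and f=G and f'=D])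
    show "(G has_derivative D x) (at x within ball p0 R)" if "x \<in> ball p0 R" for x
    proof (rule has_derivative_at_withinI, rule diff)
      show "x \<in> W" using that R(2) by auto
    qed
    show "onorm (D x) \<le> L" if "x \<in> ball p0 R" for x by (rule onormD[OF that])
  qed (rule convex_ball p q)+
  moreover have "L \<ge> 0" unfolding L_def using B_nonneg by (intro sum_nonneg)
  ultimately have "L \<ge> 0 \<and> (\<forall>p\<in>ball p0 R. \<forall>q\<in>ball p0 R. norm (G p - G q) \<le> L * norm (p - q))"
    by (intro conjI ballI)
  then have "\<exists>L\<ge>0. \<forall>p\<in>ball p0 R. \<forall>q\<in>ball p0 R. norm (G p - G q) \<le> L * norm (p - q)"
    by (rule exI[of _ L])
  from conjI[OF R(1) this] show ?thesis by (rule exI[of _ R])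
qed

lemma Ck_on_closed_imp_lipschitz_near:
  assumes F: "Ck_on_closed r (closure U) F" and "r \<ge> 1" "open U" "p0 \<in> U"
  shows "\<exists>R>0. \<exists>L\<ge>0. ball p0 R \<subseteq> U \<and>
    (\<forall>p\<in>ball p0 R. \<forall>q\<in>ball p0 R. norm (F p - F q) \<le> L * norm (p - q))"
proof -
  obtain W G where G: "open W" "closure U \<subseteq> W" "Ck_on r W G" "\<forall>x\<in>closure U. F x = G x"
    using F unfolding Ck_on_closed_def by blast
  have sub: "U \<subseteq> closure U" by (rule closure_subset)
  have "p0 \<in> W" using assms(4) sub G(2) by blast
  from Ck_on_imp_lipschitz_near[OF G(3) \<open>r \<ge> 1\<close> G(1) this]
  obtain R L where R: "R > 0" "L \<ge> 0"
    and lip: "\<forall>p\<in>ball p0 R. \<forall>q\<in>ball p0 R. norm (G p - G q) \<le> L * norm (p - q)"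
    by blast
  obtain R' where R': "R' > 0" "ball p0 R' \<subseteq> U" using assms(3,4) open_contains_ball by blast
  let ?m = "min R R'"
  have "p \<in> ball p0 R \<and> p \<in> U \<and> F p = G p" if "p \<in> ball p0 ?m" for p
  proof -
    have "p \<in> U" using that R'(2) by auto
    then show ?thesis using that G(4) sub by auto
  qed
  note near = this
  have "ball p0 ?m \<subseteq> U" by (intro subsetI) (use near in blast)
  moreover have "\<forall>p\<in>ball p0 ?m. \<forall>q\<in>ball p0 ?m. norm (F p - F q) \<le> L * norm (p - q)"
  proof (intro ballI)
    fix p q assume "p \<in> ball p0 ?m" "q \<in> ball p0 ?m"
    note near[OF this(1)] near[OF this(2)]
    then show "norm (F p - F q) \<le> L * norm (p - q)" using lip by simp
  qed
  ultimately have "L \<ge> 0 \<and> ball p0 ?m \<subseteq> U \<and>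
      (\<forall>p\<in>ball p0 ?m. \<forall>q\<in>ball p0 ?m. norm (F p - F q) \<le> L * norm (p - q))"
    using R(2) by (intro conjI)
  then have ex: "\<exists>L\<ge>0. ball p0 ?m \<subseteq> U \<and>
      (\<forall>p\<in>ball p0 ?m. \<forall>q\<in>ball p0 ?m. norm (F p - F q) \<le> L * norm (p - q))"
    by (rule exI[of _ L])
  have "?m > 0" using R(1) R'(1) by simp
  from conjI[OF this ex] show ?thesis by (rule exI[of _ ?m])
qed

lemma sgn_eq_near:
  fixes F :: field2
  assumes "isCont F p0" and "\<And>i. F p0 $ i \<noteq> 0"
  shows "\<exists>\<rho>>0. \<forall>p\<in>ball p0 \<rho>. \<forall>i. sgn (F p $ i) = sgn (F p0 $ i)"
proof -
  have "\<forall>\<^sub>F p in nhds p0. sgn (F p $ i) = sgn (F p0 $ i)" for i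
  proof -
    have "(F \<longlongrightarrow> F p0) (nhds p0)" using assms(1) 
      by (simp only: isCont_def tendsto_at_iff_tendsto_nhds)
    then have "((\<lambda>p. F p $ i * F p0 $ i) \<longlongrightarrow> F p0 $ i * F p0 $ i) (nhds p0)"
      by (intro tendsto_intros)
    moreover have "F p0 $ i * F p0 $ i > 0" using assms(2) by (metis not_real_square_gt_zero)
    ultimately have "\<forall>\<^sub>F p in nhds p0. 0 < F p $ i * F p0 $ i" by (rule order_tendstoD(1))
    then show ?thesis
    proof eventually_elim
      case (elim p)
      then show ?case by (auto simp: zero_less_mult_iff)
    qed
  qed
  then have "\<forall>\<^sub>F p in nhds p0. \<forall>i. sgn (F p $ i) = sgn (F p0 $ i)"
    by (intro eventually_all_finite)
  then obtain \<rho> where "\<rho> > 0" "\<forall>p. dist p p0 < \<rho> \<longrightarrow> (\<forall>i. sgn (F p $ i) = sgn (F p0 $ i))"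
    unfolding eventually_nhds_metric by blast
  moreover have "dist p p0 < \<rho>" if "p \<in> ball p0 \<rho>" for p using that by (simp add: dist_commute)
  ultimately show ?thesis by blast
qed

text \<open>The trajectory through the origin stays in the two opposite quadrants that contain \<open>v\<close> and \<open>- v\<close>.
  The field that governs them plays the part of \<open>F\<close> in the gluing: it is \<open>X\<close> if \<open>v\<close> points into \<open>Upos\<close>, and \<open>Y\<close> otherwise.\<close>

lemma exists_crossing_time_map:
  assumes X: "time_chart X \<rho> kX" and Y: "time_chart Y \<rho> kY" and "\<rho> > 0"
    and v: "\<And>i. v $ i \<noteq> 0" "\<And>i. sgn (X 0 $ i) = v $ i" "\<And>i. sgn (Y 0 $ i) = v $ i"
  shows "\<exists>\<delta>>0. \<exists>H. continuous_on (ball 0 \<delta>) H \<and> inj_on H (ball 0 \<delta>) \<and>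
    (\<forall>p\<in>ball 0 \<delta>. \<forall>i. sgn (H p $ i) = v $ i * sgn (p $ i)) \<and>
    (\<forall>g. g 0 \<in> ball 0 \<delta> \<and> smooth_germ X g \<and> g 0 $ 1 * g 0 $ 2 > 0 \<longrightarrow>
       (\<exists>e>0. \<forall>s\<in>{-e<..<e}. H (g s) = H (g 0) + vec s)) \<and>
    (\<forall>g. g 0 \<in> ball 0 \<delta> \<and> smooth_germ Y g \<and> g 0 $ 1 * g 0 $ 2 < 0 \<longrightarrow>
       (\<exists>e>0. \<forall>s\<in>{-e<..<e}. H (g s) = H (g 0) + vec s))"
proof -
  have X0: "X 0 $ i \<noteq> 0" and Y0: "Y 0 $ i \<noteq> 0" for i
    using v(1)[of i] v(2)[of i] v(3)[of i] by auto
  have prod: "sgn (X 0 $ 1 * X 0 $ 2) = v $ 1 * v $ 2" "sgn (Y 0 $ 1 * Y 0 $ 2) = v $ 1 * v $ 2"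
    by (simp_all add: sgn_mult v)
  have pos_factor: "c * m > 0 \<longleftrightarrow> m > 0" "c * m < 0 \<longleftrightarrow> m < 0" if "c > 0" for c m :: real
    using that by (simp_all add: zero_less_mult_iff mult_less_0_iff)
  have neg_factor: "c * m > 0 \<longleftrightarrow> m < 0" "c * m < 0 \<longleftrightarrow> m > 0" if "c < 0" for c m :: real
    using that by (simp_all add: zero_less_mult_iff mult_less_0_iff)
  have "v $ 1 * v $ 2 \<noteq> 0" using v(1) by simp
  then consider "v $ 1 * v $ 2 > 0" | "v $ 1 * v $ 2 < 0" by linarith
  then show ?thesis
  proof cases
    case 1
    then have "X 0 $ 1 * X 0 $ 2 > 0" using prod(1) by (metis sgn_greater)
    note c = pos_factor[OF this]
    have "sgn (Y 0 $ i) = sgn (X 0 $ i)" for i by (simp only: v)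
    from glue_time_charts[OF X Y \<open>\<rho> > 0\<close> X0 this] show ?thesis unfolding c v(2) .
  next
    case 2
    then have "Y 0 $ 1 * Y 0 $ 2 < 0" using prod(2) by (metis sgn_less)
    note c = neg_factor[OF this]
    have "sgn (X 0 $ i) = sgn (Y 0 $ i)" for i by (simp only: v)
    from glue_time_charts[OF Y X \<open>\<rho> > 0\<close> Y0 this] show ?thesis
      unfolding c v(3)
      by (elim exE conjE) (rule exI, rule conjI, assumption, rule exI, intro conjI; assumption)
  qed
qed

text \<open>The crossing times advance at unit rate, with positive sign on the side that \<open>v\<close> points to.  Multiplying
  them by the components of \<open>v\<close>, which are \<open>1\<close> or \<open>-1\<close>, gives a map that moves with velocity \<open>v\<close> and
  keeps the signs of the coordinates.\<close>

lemma exists_crossing_chart: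
  assumes "r \<ge> 1" "open U" "0 \<in> U" "(X, Y) \<in> Omega r U"
    and cross: "\<forall>i. X 0 $ i * Y 0 $ i > 0"
    and v: "\<And>i. v $ i = sgn (X 0 $ i)"
  shows "\<exists>\<rho>>0. \<exists>h. crossing_chart U (ball 0 \<rho>) X Y v h \<and> h ` ball 0 \<rho> \<subseteq> U \<and>
    (\<forall>p\<in>ball 0 \<rho>. \<forall>i. sgn (h p $ i) = sgn (p $ i))"
proof -
  have X0: "X 0 $ i \<noteq> 0" and Y0: "Y 0 $ i \<noteq> 0" for i using cross[rule_format, of i] by auto
  have XY0: "sgn (Y 0 $ i) = sgn (X 0 $ i)" for i
    using cross[rule_format, of i] by (auto simp: zero_less_mult_iff)
  have vnz: "v $ i \<noteq> 0" for i by (simp add: v X0 sgn_zero_iff)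
  have near: "\<exists>\<rho>>0. \<exists>k. ball 0 \<rho> \<subseteq> U \<and> time_chart F \<rho> k \<and> (\<forall>p\<in>ball 0 \<rho>. \<forall>i. sgn (F p $ i) = sgn (F 0 $ i))"
    if F: "Ck_on_closed r (closure U) F" and F0: "\<And>i. F 0 $ i \<noteq> 0" for F
  proof -
    obtain R L where R: "R > 0" "L \<ge> 0" "ball 0 R \<subseteq> U"
      and lip: "\<And>p q. p \<in> ball 0 R \<Longrightarrow> q \<in> ball 0 R \<Longrightarrow> norm (F p - F q) \<le> L * norm (p - q)"
      using Ck_on_closed_imp_lipschitz_near[OF F assms(1-3)] by blast
    obtain \<rho>1 k where k: "\<rho>1 > 0" "time_chart F \<rho>1 k"
      using exists_time_chart[OF R(1) lip R(2) F0] by blast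
    have "continuous_on (ball 0 R) F"
      by (rule lipschitz_on_continuous_on[of L], rule lipschitz_onI) (use lip R(2) in \<open>auto simp: dist_norm\<close>)
    then have "isCont F 0" using R(1) by (auto simp: continuous_on_eq_continuous_at)
    from sgn_eq_near[OF this F0] obtain \<rho>2 where \<rho>2: "\<rho>2 > 0" "\<forall>p\<in>ball 0 \<rho>2. \<forall>i. sgn (F p $ i) = sgn (F 0 $ i)"
      by blast
    define \<rho> where "\<rho> = min R (min \<rho>1 \<rho>2)"
    have "\<rho> > 0" "\<rho> \<le> R" "\<rho> \<le> \<rho>1" "\<rho> \<le> \<rho>2" using R(1) k(1) \<rho>2(1) by (auto simp: \<rho>_def)
    moreover have "time_chart F \<rho> k" by (rule time_chart_subset[OF k(2)]) fact
    moreover have "ball 0 \<rho> \<subseteq> U" using R(3) subset_ball[OF \<open>\<rho> \<le> R\<close>] by blast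
    moreover have "\<forall>p\<in>ball 0 \<rho>. \<forall>i. sgn (F p $ i) = sgn (F 0 $ i)"
      using \<rho>2(2) subset_ball[OF \<open>\<rho> \<le> \<rho>2\<close>] by blast
    ultimately have "\<rho> > 0 \<and> ball 0 \<rho> \<subseteq> U \<and> time_chart F \<rho> k \<and>
        (\<forall>p\<in>ball 0 \<rho>. \<forall>i. sgn (F p $ i) = sgn (F 0 $ i))" by (intro conjI)
    then show ?thesis by (elim conjE) (rule exI[of _ \<rho>], rule conjI, assumption, rule exI[of _ k], intro conjI)
  qed
  have "Ck_on_closed r (closure U) X" "Ck_on_closed r (closure U) Y" using assms(4) by (auto simp: Omega_def)
  from near[OF this(1) X0] near[OF this(2) Y0]
  obtain \<rho>X kX \<rho>Y kY where
    X: "\<rho>X > 0" "ball 0 \<rho>X \<subseteq> U" "time_chart X \<rho>X kX" "\<forall>p\<in>ball 0 \<rho>X. \<forall>i. sgn (X p $ i) = sgn (X 0 $ i)" and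
    Y: "\<rho>Y > 0" "ball 0 \<rho>Y \<subseteq> U" "time_chart Y \<rho>Y kY" "\<forall>p\<in>ball 0 \<rho>Y. \<forall>i. sgn (Y p $ i) = sgn (Y 0 $ i)"
    by (elim exE conjE)
  define \<rho>0 where "\<rho>0 = min \<rho>X \<rho>Y"
  have \<rho>0: "\<rho>0 > 0" "\<rho>0 \<le> \<rho>X" "\<rho>0 \<le> \<rho>Y" using X(1) Y(1) by (auto simp: \<rho>0_def)
  have tX: "time_chart X \<rho>0 kX" and tY: "time_chart Y \<rho>0 kY"
    using time_chart_subset[OF X(3)] time_chart_subset[OF Y(3)] \<rho>0 by auto
  have vX: "sgn (X 0 $ i) = v $ i" and vY: "sgn (Y 0 $ i) = v $ i" for i using v XY0 by auto
  obtain \<delta>0 H where \<delta>0: "\<delta>0 > 0" and contH: "continuous_on (ball 0 \<delta>0) H" and injH: "inj_on H (ball 0 \<delta>0)"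
    and sgnH: "\<forall>p\<in>ball 0 \<delta>0. \<forall>i. sgn (H p $ i) = v $ i * sgn (p $ i)"
    and flowX: "\<forall>g. g 0 \<in> ball 0 \<delta>0 \<and> smooth_germ X g \<and> g 0 $ 1 * g 0 $ 2 > 0 \<longrightarrow>
       (\<exists>e>0. \<forall>s\<in>{-e<..<e}. H (g s) = H (g 0) + vec s)"
    and flowY: "\<forall>g. g 0 \<in> ball 0 \<delta>0 \<and> smooth_germ Y g \<and> g 0 $ 1 * g 0 $ 2 < 0 \<longrightarrow>
       (\<exists>e>0. \<forall>s\<in>{-e<..<e}. H (g s) = H (g 0) + vec s)"
    using exists_crossing_time_map[OF tX tY \<rho>0(1) vnz vX vY] by (elim exE conjE)
  define h where "h p = (\<chi> i. v $ i * H p $ i)" for p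
  have conth: "continuous_on (ball 0 \<delta>0) h"
    unfolding h_def by (intro continuous_on_vec_lambda continuous_intros contH)
  have injh: "inj_on h (ball 0 \<delta>0)"
  proof (rule inj_onI)
    fix p q :: plane assume pq: "p \<in> ball 0 \<delta>0" "q \<in> ball 0 \<delta>0" and "h p = h q"
    then have "H p = H q" using vnz by (simp add: h_def vec_eq_iff)
    then show "p = q" using inj_onD[OF injH] pq by blast
  qed
  have vv: "sgn (v $ i) * v $ i = 1" for i using X0[of i] by (simp add: v sgn_real_def)
  have sgnh: "sgn (h p $ i) = sgn (p $ i)" if "p \<in> ball 0 \<delta>0" for p i
  proof -
    have "sgn (h p $ i) = sgn (v $ i) * (v $ i * sgn (p $ i))" using sgnH that by (simp add: h_def sgn_mult)
    also have "\<dots> = (sgn (v $ i) * v $ i) * sgn (p $ i)" by (rule mult.assoc[symmetric])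
    finally show ?thesis by (simp only: vv mult_1_left)
  qed
  have h_vec: "h p = h q + s *\<^sub>R v" if "H p = H q + vec s" for p q s
    unfolding h_def that by (simp add: vec_eq_iff algebra_simps)
  have h0: "h 0 = 0" using sgnh[of 0] \<delta>0 by (simp add: vec_eq_iff sgn_zero_iff)
  have "open (ball 0 \<delta>0 \<inter> h -` U)" by (rule continuous_open_preimage[OF conth open_ball \<open>open U\<close>])
  moreover have "0 \<in> ball 0 \<delta>0 \<inter> h -` U" using \<delta>0 h0 \<open>0 \<in> U\<close> by simp
  ultimately obtain \<rho>1 where \<rho>1: "\<rho>1 > 0" "ball 0 \<rho>1 \<subseteq> ball 0 \<delta>0 \<inter> h -` U"
    using open_contains_ball by blast
  define \<rho> where "\<rho> = min \<rho>1 \<rho>0"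
  have "\<rho> > 0" using \<rho>1(1) \<rho>0(1) by (simp add: \<rho>_def)
  have in\<delta>: "p \<in> ball 0 \<delta>0" and inU: "h p \<in> U" if "p \<in> ball 0 \<rho>" for p
    using that \<rho>1(2) by (auto simp: \<rho>_def)
  have inX: "p \<in> ball 0 \<rho>X" and inY: "p \<in> ball 0 \<rho>Y" and in\<rho>0: "p \<in> ball 0 \<rho>0"
    if "p \<in> ball 0 \<rho>" for p :: plane
    using that \<rho>0 by (auto simp: \<rho>_def)
  have sub: "ball 0 \<rho> \<subseteq> ball (0::plane) \<delta>0" using in\<delta> by blast
  have v_sgn: "sgn (v $ i) = v $ i" for i by (simp add: v sgn_real_def)
  have chart: "crossing_chart U (ball 0 \<rho>) X Y v h"
  proof
    show "open (ball (0::plane) \<rho>)" by simp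
    show "ball 0 \<rho> \<subseteq> U" using inX X(2) by blast
    show "continuous_on (ball 0 \<rho>) h" by (rule continuous_on_subset[OF conth sub])
    show "inj_on h (ball 0 \<rho>)" by (rule inj_on_subset[OF injh sub])
    show "v $ i \<noteq> 0" for i by (rule vnz)
    show "sgn (X p $ i) = sgn (v $ i)" if "p \<in> ball 0 \<rho>" for p i
    proof -
      have "sgn (X p $ i) = sgn (X 0 $ i)" using X(4) inX[OF that] by blast
      then show ?thesis by (simp only: vX v_sgn)
    qed
    show "sgn (Y p $ i) = sgn (v $ i)" if "p \<in> ball 0 \<rho>" for p i
    proof -
      have "sgn (Y p $ i) = sgn (Y 0 $ i)" using Y(4) inY[OF that] by blast
      then show ?thesis by (simp only: vY v_sgn)
    qed
    show "\<exists>g. g 0 = p \<and> smooth_germ X g" if "p \<in> ball 0 \<rho>" for p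
      using tX in\<rho>0[OF that] by (simp add: time_chart_def)
    show "\<exists>g. g 0 = p \<and> smooth_germ Y g" if "p \<in> ball 0 \<rho>" for p
      using tY in\<rho>0[OF that] by (simp add: time_chart_def)
    show "\<exists>e>0. \<forall>s\<in>{-e<..<e}. h (g s) = h (g 0) + s *\<^sub>R v"
      if g: "g 0 \<in> ball 0 \<rho>" "g 0 \<in> Upos U" "smooth_germ X g" for g
    proof -
      have "g 0 $ 1 * g 0 $ 2 > 0" using g(2) by (simp add: Upos_def)
      with in\<delta>[OF g(1)] g(3) have "g 0 \<in> ball 0 \<delta>0 \<and> smooth_germ X g \<and> g 0 $ 1 * g 0 $ 2 > 0"
        by (intro conjI)
      from flowX[THEN spec, THEN mp, OF this]
      obtain e where e: "e > 0" "\<forall>s\<in>{-e<..<e}. H (g s) = H (g 0) + vec s"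
        by (elim exE conjE)
      show ?thesis by (intro exI[of _ e] conjI ballI e(1) h_vec bspec[OF e(2)])
    qed
    show "\<exists>e>0. \<forall>s\<in>{-e<..<e}. h (g s) = h (g 0) + s *\<^sub>R v"
      if g: "g 0 \<in> ball 0 \<rho>" "g 0 \<in> Uneg U" "smooth_germ Y g" for g
    proof -
      have "g 0 $ 1 * g 0 $ 2 < 0" using g(2) by (simp add: Uneg_def)
      with in\<delta>[OF g(1)] g(3) have "g 0 \<in> ball 0 \<delta>0 \<and> smooth_germ Y g \<and> g 0 $ 1 * g 0 $ 2 < 0"
        by (intro conjI)
      from flowY[THEN spec, THEN mp, OF this]
      obtain e where e: "e > 0" "\<forall>s\<in>{-e<..<e}. H (g s) = H (g 0) + vec s"
        by (elim exE conjE)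
      show ?thesis by (intro exI[of _ e] conjI ballI e(1) h_vec bspec[OF e(2)])
    qed
  qed
  show ?thesis
  proof (rule exI[of _ \<rho>], rule conjI[OF \<open>\<rho> > 0\<close>], rule exI[of _ h], intro conjI ballI allI)
    show "h ` ball 0 \<rho> \<subseteq> U" using inU by blast
    show "sgn (h p $ i) = sgn (p $ i)" if "p \<in> ball 0 \<rho>" for p i by (rule sgnh[OF in\<delta>[OF that]])
  qed (rule chart)
qed

text \<open>The constant field is its own straightening.  This gives its trajectories the same local description as
  those of the original system, including at the axes and at the origin.\<close>

lemma constant_crossing_chart:
  assumes "open V" "V \<subseteq> U" "\<And>i. v $ i \<noteq> 0"
  shows "crossing_chart U V (\<lambda>p. v) (\<lambda>p. v) v (\<lambda>p. p)"
proof -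
  have line: "\<exists>g. g 0 = p \<and> smooth_germ (\<lambda>p. v) g" for p
    unfolding smooth_germ_const_iff
    by (rule exI[of _ "\<lambda>s. p + s *\<^sub>R v"]) (auto intro!: exI[of _ "1::real"])
  have flow: "\<exists>e>0. \<forall>s\<in>{-e<..<e}. g s = g 0 + s *\<^sub>R v" if "smooth_germ (\<lambda>p. v) g" for g
    using that unfolding smooth_germ_const_iff .
  show "crossing_chart U V (\<lambda>p. v) (\<lambda>p. v) v (\<lambda>p. p)"
    by (intro crossing_chart.intro assms line flow continuous_on_id) simp_all
qed

theorem proposition3p7:
  fixes r :: nat and U :: "(real^2) set" and X Y :: "real^2 \<Rightarrow> real^2" and a b :: real
  assumes "r \<ge> 1"
    and "open U" and "bounded U" and "0 \<in> U"
    and "(X, Y) \<in> Omega r U"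
    and "\<forall>i. X 0 $ i * Y 0 $ i > 0"
    and "a = sgn (X 0 $ 1)" and "b = sgn (X 0 $ 2)"
  shows "locally_Sigma_equivalent r U (X, Y) ((\<lambda>p. vector [a, b]), (\<lambda>p. vector [a, b])) \<and>
         locally_C0_equivalent U (X, Y) (\<lambda>p. vector [a, b])"
proof -
  define v :: plane where "v = vector [a, b]"
  have v_sgn: "v $ i = sgn (X 0 $ i)" for i
    using exhaust_2[of i] assms(7,8) by (auto simp: v_def)
  have v_nz: "v $ i \<noteq> 0" for i
    using assms(6)[rule_format, of i] by (auto simp: v_sgn sgn_zero_iff)
  obtain \<rho> h where \<rho>: "\<rho> > 0" and chart: "crossing_chart U (ball 0 \<rho>) X Y v h"
    and hU: "h ` ball 0 \<rho> \<subseteq> U" and sgn_h: "\<forall>p\<in>ball 0 \<rho>. \<forall>i. sgn (h p $ i) = sgn (p $ i)"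
    using exists_crossing_chart[OF assms(1,2,4,5,6) v_sgn] by (elim exE conjE)
  define V where "V = ball (0::plane) \<rho>"
  define V' where "V' = h ` V"
  interpret Z: crossing_chart U V X Y v h unfolding V_def by (rule chart)
  have "open V'" unfolding V'_def by (rule invariance_of_domain[OF Z.cont_h Z.open_V Z.inj_h])
  have "V' \<subseteq> U" using hU by (simp add: V'_def V_def)
  interpret L: crossing_chart U V' "\<lambda>p. v" "\<lambda>p. v" v "\<lambda>p. p"
    by (rule constant_crossing_chart[OF \<open>open V'\<close> \<open>V' \<subseteq> U\<close> v_nz])
  obtain h' where hom: "homeomorphism V V' h h'"
    unfolding V'_def by (rule invariance_of_domain_homeomorphism[OF Z.open_V Z.cont_h _ Z.inj_h]) auto
  interpret S: germ_conjugacy V V' h h' "trajectory_germ U (X, Y)" "trajectory_germ U (\<lambda>p. v, \<lambda>p. v)" v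
    by unfold_locales
      (simp_all only: hom Z.trajectory_germ_iff_straight L.trajectory_germ_iff_straight Z.straight_def L.straight_def)
  interpret C: germ_conjugacy V V' h h' "trajectory_germ U (X, Y)" "smooth_germ (\<lambda>p. v)" v
  proof
    fix g :: germ assume g: "g 0 \<in> V'"
    show "smooth_germ (\<lambda>p. v) g \<longleftrightarrow> (\<exists>e>0. \<forall>s\<in>{-e<..<e}. g s \<in> V' \<and> g s = g 0 + s *\<^sub>R v)"
    proof
      assume sg: "smooth_germ (\<lambda>p. v) g"
      then obtain d where d: "d > 0" "\<forall>s\<in>{-d<..<d}. g s = g 0 + s *\<^sub>R v"
        unfolding smooth_germ_const_iff by (elim exE conjE)
      obtain e where e: "e > 0" "\<forall>s\<in>{-e<..<e}. g s \<in> V'"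
        using smooth_germ_continuous_near[OF sg \<open>open V'\<close> g] by (elim exE conjE)
      have "min d e > 0" using d(1) e(1) by simp
      moreover have "g s \<in> V' \<and> g s = g 0 + s *\<^sub>R v" if "s \<in> {-min d e<..<min d e}" for s
        by (intro conjI bspec[OF e(2) symmetric_interval_min(2)[OF that]]
            bspec[OF d(2) symmetric_interval_min(1)[OF that]])
      ultimately show "\<exists>e>0. \<forall>s\<in>{-e<..<e}. g s \<in> V' \<and> g s = g 0 + s *\<^sub>R v" by blast
    next
      assume "\<exists>e>0. \<forall>s\<in>{-e<..<e}. g s \<in> V' \<and> g s = g 0 + s *\<^sub>R v"
      then show "smooth_germ (\<lambda>p. v) g" unfolding smooth_germ_const_iff by blast
    qed
  qed (simp_all only: hom S.P_iff)
  have orient: "orientation_preserving_on V h"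
    unfolding V_def
    by (rule orientation_preserving_if_sgn[OF _ _ \<rho>])
      (use Z.cont_h Z.inj_h sgn_h in \<open>simp_all add: V_def\<close>)
  have "0 \<in> ball (0::plane) \<rho>" using \<rho> by simp
  then have "sgn (h 0 $ i) = sgn ((0::plane) $ i)" for i using sgn_h by blast
  then have "h 0 = 0" by (simp add: vec_eq_iff sgn_zero_iff)
  have "0 \<in> V" using \<rho> by (simp add: V_def)
  then have "0 \<in> V'" unfolding V'_def using \<open>h 0 = 0\<close> by (metis image_eqI)
  have Sig: "h ` (Sig U \<inter> V) = Sig U \<inter> V'"
  proof -
    have "h p \<in> Sig U \<longleftrightarrow> p \<in> Sig U" if "p \<in> V" for p
    proof -
      have "h p $ i = 0 \<longleftrightarrow> p $ i = 0" for i using sgn_h that unfolding V_def by (metis sgn_eq_0_iff)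
      moreover have "p \<in> U" "h p \<in> U" using that Z.V_sub hU unfolding V_def by auto
      ultimately show ?thesis by (simp add: Sig_def)
    qed
    then show ?thesis unfolding V'_def by auto
  qed
  have "((\<lambda>p. v), (\<lambda>p. v)) \<in> Omega r U"
    unfolding Omega_def Ck_on_closed_def by (auto intro!: exI[of _ UNIV] exI[of _ "\<lambda>p. v"] Ck_on_const)
  moreover have "equivalence_via V V' h (trajectories U (X, Y) V) (trajectories U (\<lambda>p. v, \<lambda>p. v) V')"
    unfolding equivalence_via_def trajectories_def using hom orient S.maps_maximal_curves by blast
  moreover have "equivalence_via V V' h (trajectories U (X, Y) V) (integral_curves (\<lambda>p. v) V')"
    unfolding equivalence_via_def trajectories_def integral_curves_def
    using hom orient C.maps_maximal_curves by blast
  ultimately show ?thesis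
    unfolding locally_Sigma_equivalent_def locally_C0_equivalent_def v_def[symmetric]
    using assms(5) Z.open_V Z.V_sub \<open>open V'\<close> \<open>V' \<subseteq> U\<close> \<open>0 \<in> V\<close> \<open>0 \<in> V'\<close> Sig by blast
qed

end
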